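(* Let $A=[A(i,j)]_{i,j=1}^N$ be an irreducible non-permutation matrix with entries in $\{0,1\}$. There are no KMS states on $\mathcal{O}_{A^\infty}$ for any of the actions $\alpha,\beta,\gamma$. Similarly, $\widehat{\mathcal{O}}_A$ has no KMS states for any of the actions $\hat\alpha^A,\hat\beta^A,\hat\gamma^A$.
   Context: For a $\{0,1\}$-matrix $B=[B(i,j)]_{i,j=1}^N$ (irreducible, non-permutation), $\mathcal{O}_{B^\infty}$ is the universal unital $C^*$-algebra generated by partial isometries $S_i$, $i\in\mathbb{N}$, with $\sum_{j=1}^nS_jS_j^*\le1$ for all $n$; $S_i^*S_i=\sum_{j=1}^NB(i,j)S_jS_j^*+1-\sum_{j=1}^NS_jS_j^*$ for $1\le i\le N$; $S_i^*S_i=1$ for $i>N$. Put $P_N=1-\sum_{j=1}^NS_jS_j^*$. The actions on $\mathcal{O}_{B^\infty}$ (of $\mathbb{R}/\mathbb{Z}$, viewed as one-parameter actions of $\mathbb{R}$) are: $\alpha_t(S_j)=e^{2\pi it}S_j$ for $j\le N$, $\alpha_t(S_j)=S_j$ for $j>N$; $\beta_t(S_j)=S_j$ for $j\le N$, $\beta_t(S_j)=e^{2\pi it}S_j$ for $j>N$; $\gamma_t(S_j)=e^{2\pi it}S_j$ for all $j$. They fix $P_N$. The reciprocal dual $\widehat{\mathcal{O}}_A$ of the Cuntz–Krieger algebra $\mathcal{O}_A$ is realized as $P_N\mathcal{O}_{B^\infty}P_N$ with $B=A^t$ the transpose of $A$, and $\hat\alpha^A,\hat\beta^A,\hat\gamma^A$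 are the restrictions to it of $\alpha,\beta,\gamma$ on $\mathcal{O}_{(A^t)^\infty}$. A KMS state for a one-parameter action $\sigma$ is a state $\varphi$ such that, for some (finite) inverse temperature $b\in\mathbb{R}$, $\varphi(x\sigma_{ib}(y))=\varphi(yx)$ for all $x,y$ in a dense $\sigma$-invariant $*$-subalgebra of entire analytic elements. *)

theory Defs
  imports
    Complex_Main
    "HOL-Algebra.Module"
    "HOL-Combinatorics.Permutations"
    "HOL-Library.Nonpos_Ints"
    "Jordan_Normal_Form.Matrix"
begin

text \<open>
  Matrices are indexed by \<open>{0..<N}\<close> and the generators of the algebras by \<open>{0, 1, 2, ...}\<close>;
  so the indices \<open>1..N\<close> and \<open>> N\<close> of the usual presentation become \<open>< N\<close> and \<open>\<ge> N\<close>.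
\<close>

section \<open>Matrices\<close>

definition irreducible_matrix :: "nat mat \<Rightarrow> bool" where
  "irreducible_matrix A \<longleftrightarrow> square_mat A \<and>
     (\<forall>i < dim_row A. \<forall>j < dim_row A. \<exists>m > 0. (A ^\<^sub>m m) $$ (i, j) > 0)"

definition permutation_matrix :: "nat mat \<Rightarrow> bool" where
  "permutation_matrix A \<longleftrightarrow>
     (\<exists>N p. p permutes {..<N} \<and> A = mat N N (\<lambda>(i, j). if j = p i then 1 else 0))"


section \<open>Unital C*-algebras\<close>

record 'a cstar_alg = "(complex, 'a) module" +
  star :: "'a \<Rightarrow> 'a"
  cnorm :: "'a \<Rightarrow> real"

locale unital_cstar_algebra = ring A for A :: "'a cstar_alg" (structure) +
  assumes scale_closed: "x \<in> carrier A \<Longrightarrow> c \<odot> x \<in> carrier A"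
    and scale_add_left: "x \<in> carrier A \<Longrightarrow> (c + d) \<odot> x = (c \<odot> x) \<oplus> (d \<odot> x)"
    and scale_add_right:
      "\<lbrakk>x \<in> carrier A; y \<in> carrier A\<rbrakk> \<Longrightarrow> c \<odot> (x \<oplus> y) = (c \<odot> x) \<oplus> (c \<odot> y)"
    and scale_scale: "x \<in> carrier A \<Longrightarrow> (c * d) \<odot> x = c \<odot> (d \<odot> x)"
    and scale_one: "x \<in> carrier A \<Longrightarrow> 1 \<odot> x = x"
    and scale_mult_left:
      "\<lbrakk>x \<in> carrier A; y \<in> carrier A\<rbrakk> \<Longrightarrow> (c \<odot> x) \<otimes> y = c \<odot> (x \<otimes> y)"
    and scale_mult_right:
      "\<lbrakk>x \<in> carrier A; y \<in> carrier A\<rbrakk> \<Longrightarrow> x \<otimes> (c \<odot> y) = c \<odot> (x \<otimes> y)"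
    and star_closed: "x \<in> carrier A \<Longrightarrow> star A x \<in> carrier A"
    and star_star: "x \<in> carrier A \<Longrightarrow> star A (star A x) = x"
    and star_add:
      "\<lbrakk>x \<in> carrier A; y \<in> carrier A\<rbrakk> \<Longrightarrow> star A (x \<oplus> y) = star A x \<oplus> star A y"
    and star_scale: "x \<in> carrier A \<Longrightarrow> star A (c \<odot> x) = cnj c \<odot> star A x"
    and star_mult:
      "\<lbrakk>x \<in> carrier A; y \<in> carrier A\<rbrakk> \<Longrightarrow> star A (x \<otimes> y) = star A y \<otimes> star A x"
    and norm_ge_zero: "x \<in> carrier A \<Longrightarrow> 0 \<le> cnorm A x"
    and norm_eq_zero: "x \<in> carrier A \<Longrightarrow> cnorm A x = 0 \<longleftrightarrow> x = \<zero>"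
    and norm_triangle:
      "\<lbrakk>x \<in> carrier A; y \<in> carrier A\<rbrakk> \<Longrightarrow> cnorm A (x \<oplus> y) \<le> cnorm A x + cnorm A y"
    and norm_scale: "x \<in> carrier A \<Longrightarrow> cnorm A (c \<odot> x) = cmod c * cnorm A x"
    and norm_mult:
      "\<lbrakk>x \<in> carrier A; y \<in> carrier A\<rbrakk> \<Longrightarrow> cnorm A (x \<otimes> y) \<le> cnorm A x * cnorm A y"
    and cstar_identity: "x \<in> carrier A \<Longrightarrow> cnorm A (star A x \<otimes> x) = (cnorm A x)\<^sup>2"
    and complete:
      "\<lbrakk>\<And>n. f n \<in> carrier A;
        \<And>e. e > 0 \<Longrightarrow> \<exists>n0 :: nat. \<forall>m \<ge> n0. \<forall>n \<ge> n0. cnorm A (f m \<ominus> f n) < e\<rbrakk>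
       \<Longrightarrow> \<exists>x \<in> carrier A. (\<lambda>n. cnorm A (f n \<ominus> x)) \<longlonglongrightarrow> 0"

definition cstar_le :: "'a cstar_alg \<Rightarrow> 'a \<Rightarrow> 'a \<Rightarrow> bool" where
  "cstar_le A x y \<longleftrightarrow> (\<exists>z \<in> carrier A. y \<ominus>\<^bsub>A\<^esub> x = star A z \<otimes>\<^bsub>A\<^esub> z)"

definition star_subalgebra :: "'a cstar_alg \<Rightarrow> 'a set \<Rightarrow> bool" where
  "star_subalgebra A D \<longleftrightarrow> D \<subseteq> carrier A \<and> \<zero>\<^bsub>A\<^esub> \<in> D \<and>
     (\<forall>x \<in> D. \<forall>y \<in> D. x \<oplus>\<^bsub>A\<^esub> y \<in> D \<and> x \<otimes>\<^bsub>A\<^esub> y \<in> D) \<and>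
     (\<forall>x \<in> D. star A x \<in> D \<and> (\<forall>c. c \<odot>\<^bsub>A\<^esub> x \<in> D))"

definition norm_dense :: "'a cstar_alg \<Rightarrow> 'a set \<Rightarrow> bool" where
  "norm_dense A D \<longleftrightarrow>
     (\<forall>x \<in> carrier A. \<forall>e > 0. \<exists>y \<in> D. cnorm A (x \<ominus>\<^bsub>A\<^esub> y) < e)"

text \<open>Unital *-homomorphisms; continuity is automatic.\<close>

definition star_hom :: "'a cstar_alg \<Rightarrow> 'b cstar_alg \<Rightarrow> ('a \<Rightarrow> 'b) \<Rightarrow> bool" where
  "star_hom A B h \<longleftrightarrow> h \<in> ring_hom A B \<and>
     (\<forall>x \<in> carrier A. h (star A x) = star B (h x) \<and> (\<forall>c. h (c \<odot>\<^bsub>A\<^esub> x) = c \<odot>\<^bsub>B\<^esub> h x))"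

definition star_automorphism :: "'a cstar_alg \<Rightarrow> ('a \<Rightarrow> 'a) \<Rightarrow> bool" where
  "star_automorphism A h \<longleftrightarrow> star_hom A A h \<and> bij_betw h (carrier A) (carrier A)"

text \<open>The corner \<open>p A p\<close> of a projection \<open>p\<close>, a C*-algebra with unit \<open>p\<close>.\<close>

definition corner :: "'a cstar_alg \<Rightarrow> 'a \<Rightarrow> 'a cstar_alg" where
  "corner A p = A\<lparr>carrier := {p \<otimes>\<^bsub>A\<^esub> x \<otimes>\<^bsub>A\<^esub> p |x. x \<in> carrier A}, one := p\<rparr>"

text \<open>States: positive linear functionals of norm one.\<close>

definition state :: "'a cstar_alg \<Rightarrow> ('a \<Rightarrow> complex) \<Rightarrow> bool" where
  "state A \<phi> \<longleftrightarrow>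
     (\<forall>x \<in> carrier A. \<forall>y \<in> carrier A. \<phi> (x \<oplus>\<^bsub>A\<^esub> y) = \<phi> x + \<phi> y) \<and>
     (\<forall>x \<in> carrier A. \<forall>c. \<phi> (c \<odot>\<^bsub>A\<^esub> x) = c * \<phi> x) \<and>
     (\<forall>x \<in> carrier A. \<phi> (star A x \<otimes>\<^bsub>A\<^esub> x) \<in> \<real>\<^sub>\<ge>\<^sub>0) \<and>
     bdd_above ((\<lambda>x. cmod (\<phi> x)) ` {x \<in> carrier A. cnorm A x \<le> 1}) \<and>
     (SUP x \<in> {x \<in> carrier A. cnorm A x \<le> 1}. cmod (\<phi> x)) = 1"


section \<open>One-parameter actions and KMS states\<close>

definition one_parameter_action :: "'a cstar_alg \<Rightarrow> (real \<Rightarrow> 'a \<Rightarrow> 'a) \<Rightarrow> bool" where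
  "one_parameter_action A \<sigma> \<longleftrightarrow>
     (\<forall>t. star_automorphism A (\<sigma> t)) \<and>
     (\<forall>x \<in> carrier A. \<sigma> 0 x = x) \<and>
     (\<forall>x \<in> carrier A. \<forall>s t. \<sigma> (s + t) x = \<sigma> s (\<sigma> t x)) \<and>
     (\<forall>x \<in> carrier A. \<forall>s. ((\<lambda>t. cnorm A (\<sigma> t x \<ominus>\<^bsub>A\<^esub> \<sigma> s x)) \<longlongrightarrow> 0) (at s))"

definition entire_function :: "'a cstar_alg \<Rightarrow> (complex \<Rightarrow> 'a) \<Rightarrow> bool" where
  "entire_function A F \<longleftrightarrow> (\<forall>z. F z \<in> carrier A) \<and>
     (\<forall>z. \<exists>d \<in> carrier A.
        ((\<lambda>h. cnorm A ((inverse h \<odot>\<^bsub>A\<^esub> (F (z + h) \<ominus>\<^bsub>A\<^esub> F z)) \<ominus>\<^bsub>A\<^esub> d)) \<longlongrightarrow> 0) (at 0))"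

text \<open>
  \<open>F\<close> extends the orbit \<open>t \<mapsto> \<sigma> t y\<close> to an entire function. By the identity theorem there
  is at most one such \<open>F\<close>, and \<open>F z\<close> is what is written \<open>\<sigma>\<^sub>z(y)\<close>.
\<close>

definition entire_extension ::
    "'a cstar_alg \<Rightarrow> (real \<Rightarrow> 'a \<Rightarrow> 'a) \<Rightarrow> 'a \<Rightarrow> (complex \<Rightarrow> 'a) \<Rightarrow> bool" where
  "entire_extension A \<sigma> y F \<longleftrightarrow> entire_function A F \<and> (\<forall>t :: real. F (complex_of_real t) = \<sigma> t y)"

definition entire_elements :: "'a cstar_alg \<Rightarrow> (real \<Rightarrow> 'a \<Rightarrow> 'a) \<Rightarrow> 'a set" where
  "entire_elements A \<sigma> = {y \<in> carrier A. \<exists>F. entire_extension A \<sigma> y F}"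

definition kms_state_at ::
    "'a cstar_alg \<Rightarrow> (real \<Rightarrow> 'a \<Rightarrow> 'a) \<Rightarrow> real \<Rightarrow> ('a \<Rightarrow> complex) \<Rightarrow> bool" where
  "kms_state_at A \<sigma> b \<phi> \<longleftrightarrow> state A \<phi> \<and>
     (\<exists>D. star_subalgebra A D \<and> norm_dense A D \<and> (\<forall>t. \<sigma> t ` D \<subseteq> D) \<and>
          D \<subseteq> entire_elements A \<sigma> \<and>
          (\<forall>x \<in> D. \<forall>y \<in> D. \<forall>F. entire_extension A \<sigma> y F \<longrightarrow>
             \<phi> (x \<otimes>\<^bsub>A\<^esub> F (\<i> * complex_of_real b)) = \<phi> (y \<otimes>\<^bsub>A\<^esub> x)))"

definition kms_state :: "'a cstar_alg \<Rightarrow> (real \<Rightarrow> 'a \<Rightarrow> 'a) \<Rightarrow> ('a \<Rightarrow> complex) \<Rightarrow> bool" where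
  "kms_state A \<sigma> \<phi> \<longleftrightarrow> (\<exists>b :: real. kms_state_at A \<sigma> b \<phi>)"


section \<open>The algebra \<open>O\<^bsub>B\<^sup>\<infinity>\<^esub>\<close> and its actions\<close>

definition range_sum :: "'a cstar_alg \<Rightarrow> (nat \<Rightarrow> 'a) \<Rightarrow> nat \<Rightarrow> 'a" where
  "range_sum A S n = (\<Oplus>\<^bsub>A\<^esub>j \<in> {..<n}. S j \<otimes>\<^bsub>A\<^esub> star A (S j))"

definition defect_projection :: "'a cstar_alg \<Rightarrow> (nat \<Rightarrow> 'a) \<Rightarrow> nat \<Rightarrow> 'a" where
  "defect_projection A S N = \<one>\<^bsub>A\<^esub> \<ominus>\<^bsub>A\<^esub> range_sum A S N"

definition O_infty_relations :: "nat mat \<Rightarrow> 'a cstar_alg \<Rightarrow> (nat \<Rightarrow> 'a) \<Rightarrow> bool" where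
  "O_infty_relations B A S \<longleftrightarrow>
     (\<forall>i. S i \<in> carrier A \<and> S i \<otimes>\<^bsub>A\<^esub> star A (S i) \<otimes>\<^bsub>A\<^esub> S i = S i) \<and>
     (\<forall>n. cstar_le A (range_sum A S n) \<one>\<^bsub>A\<^esub>) \<and>
     (\<forall>i < dim_row B. star A (S i) \<otimes>\<^bsub>A\<^esub> S i =
        (\<Oplus>\<^bsub>A\<^esub>j \<in> {..<dim_row B}. of_nat (B $$ (i, j)) \<odot>\<^bsub>A\<^esub> (S j \<otimes>\<^bsub>A\<^esub> star A (S j)))
          \<oplus>\<^bsub>A\<^esub> defect_projection A S (dim_row B)) \<and>
     (\<forall>i \<ge> dim_row B. star A (S i) \<otimes>\<^bsub>A\<^esub> S i = \<one>\<^bsub>A\<^esub>)"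

definition generates :: "'a cstar_alg \<Rightarrow> (nat \<Rightarrow> 'a) \<Rightarrow> bool" where
  "generates A S \<longleftrightarrow>
     (\<forall>D. star_subalgebra A D \<and> \<one>\<^bsub>A\<^esub> \<in> D \<and> range S \<subseteq> D \<longrightarrow> norm_dense A D)"

text \<open>
  \<open>(A, S)\<close> is the universal unital C*-algebra with generators \<open>S\<close> subject to the above relations.
  A formula cannot quantify over all carrier types, but nothing is lost by testing universality on
  algebras \<open>C\<close> whose carrier is a set of real numbers: a homomorphism determined by the images
  \<open>T i\<close> takes values in the separable C*-subalgebra generated by these and the unit, whose
  cardinality is at most that of the continuum, so that it is isomorphic to such a \<open>C\<close>.
\<close>

definition is_O_infty :: "nat mat \<Rightarrow> 'a cstar_alg \<Rightarrow> (nat \<Rightarrow> 'a) \<Rightarrow> bool" where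
  "is_O_infty B A S \<longleftrightarrow> unital_cstar_algebra A \<and> O_infty_relations B A S \<and> generates A S \<and>
     (\<forall>(C :: real cstar_alg) T. unital_cstar_algebra C \<and> O_infty_relations B C T \<longrightarrow>
        (\<exists>h. star_hom A C h \<and> (\<forall>i. h (S i) = T i)))"

text \<open>
  An action is determined by its values on the generators; the number \<open>N\<close> in the following
  definitions is the size of the matrix, and \<open>cis (2 * pi * t)\<close> is \<open>e\<^bsup>2\<pi>it\<^esup>\<close>.
\<close>

definition is_alpha_action ::
    "nat \<Rightarrow> 'a cstar_alg \<Rightarrow> (nat \<Rightarrow> 'a) \<Rightarrow> (real \<Rightarrow> 'a \<Rightarrow> 'a) \<Rightarrow> bool" where
  "is_alpha_action N A S \<sigma> \<longleftrightarrow> one_parameter_action A \<sigma> \<and>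
     (\<forall>t. \<forall>j < N. \<sigma> t (S j) = cis (2 * pi * t) \<odot>\<^bsub>A\<^esub> S j) \<and>
     (\<forall>t. \<forall>j \<ge> N. \<sigma> t (S j) = S j)"

definition is_beta_action ::
    "nat \<Rightarrow> 'a cstar_alg \<Rightarrow> (nat \<Rightarrow> 'a) \<Rightarrow> (real \<Rightarrow> 'a \<Rightarrow> 'a) \<Rightarrow> bool" where
  "is_beta_action N A S \<sigma> \<longleftrightarrow> one_parameter_action A \<sigma> \<and>
     (\<forall>t. \<forall>j < N. \<sigma> t (S j) = S j) \<and>
     (\<forall>t. \<forall>j \<ge> N. \<sigma> t (S j) = cis (2 * pi * t) \<odot>\<^bsub>A\<^esub> S j)"

definition is_gamma_action ::
    "'a cstar_alg \<Rightarrow> (nat \<Rightarrow> 'a) \<Rightarrow> (real \<Rightarrow> 'a \<Rightarrow> 'a) \<Rightarrow> bool" where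
  "is_gamma_action A S \<sigma> \<longleftrightarrow> one_parameter_action A \<sigma> \<and>
     (\<forall>t j. \<sigma> t (S j) = cis (2 * pi * t) \<odot>\<^bsub>A\<^esub> S j)"

text \<open>
  The reciprocal dual of the Cuntz-Krieger algebra of \<open>A\<close> is \<open>reciprocal_dual N U S\<close> for
  \<open>is_O_infty A\<^sup>T U S\<close>, with \<open>N\<close> the size of \<open>A\<close>; the defect projection is
  fixed by the three actions, which therefore restrict to the corner.
\<close>

definition reciprocal_dual :: "nat \<Rightarrow> 'a cstar_alg \<Rightarrow> (nat \<Rightarrow> 'a) \<Rightarrow> 'a cstar_alg" where
  "reciprocal_dual N U S = corner U (defect_projection U S N)"

end

theory Submission
  imports Defs "HOL-Complex_Analysis.Complex_Analysis"
begin

text \<open>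
  The generators \<open>S\<^sub>j\<close> with \<open>j \<ge> N\<close> are infinitely many isometries with pairwise orthogonal ranges,
  and each of the three actions multiplies all of them by the same character \<open>e\<^bsup>2\<pi>ilt\<^esup>\<close>. So the
  KMS condition at inverse temperature \<open>b\<close> gives every range projection \<open>S\<^sub>j S\<^sub>j\<^sup>*\<close> the same value
  \<open>e\<^bsup>-2\<pi>lb\<^esup> \<phi>(1) > 0\<close>, while the sums of these values are bounded. In the corner of
  \<open>P\<^sub>N\<close> the same argument applies to \<open>S\<^sub>j P\<^sub>N\<close>.
\<close>

section \<open>Elementary C*-algebra theory\<close>

text \<open>Orthogonality of the ranges is not among the relations: it has to be extracted from the
  bound of the range sums by 1, where \<open>cstar_le\<close> says only that the difference has the
  form z* z. The crux is that a nonzero product y* y is never negative. Spectral theory is bypassed: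
  a self-adjoint a counts as positive when the norm of t 1 - a is at most t for some t \<ge> 0,
  square roots are limits of an explicit iteration, and growth of powers replaces the spectral
  radius.

  The second obstacle is that the dense subalgebra of the KMS condition is arbitrary and need not
  contain any S_j. The condition is carried over to S_j by approximation: the orbits have period 1,
  and averaging over one period isolates the degree of S_j. Both the periodicity and the estimates,
  uniform along orbits, rest on contractivity of *-homomorphisms, which square roots provide as
  well. Finally, \<open>state\<close> prescribes the norm of the functional and not its value at the
  unit, so that this value has to be shown to be nonzero.\<close>

lemma le_one_if_power_two_powers_le:
  fixes r c :: real
  assumes "\<And>k. r ^ (2 ^ k) \<le> 1 + 2 ^ k * c"
  shows "r \<le> 1"
proof (rule ccontr)
  assume "\<not> r \<le> 1"
  hence r: "1 < r" by simp
  have "(\<lambda>n. (1 / r) ^ n + c * (real n / r ^ n)) \<longlonglongrightarrow> 0 + c * 0"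
  proof (intro tendsto_add tendsto_mult tendsto_const)
    show "(\<lambda>n. (1 / r) ^ n) \<longlonglongrightarrow> 0"
      using r by (intro LIMSEQ_realpow_zero) auto
    have "(\<lambda>n. of_nat n * (1 / r) ^ n) \<longlonglongrightarrow> 0"
      using r by (intro powser_times_n_limit_0) auto
    thus "(\<lambda>n. real n / r ^ n) \<longlonglongrightarrow> 0"
      by (simp add: power_one_over)
  qed
  hence "eventually (\<lambda>n. (1 / r) ^ n + c * (real n / r ^ n) < 1) sequentially"
    by (intro order_tendstoD(2)[where y = 0]) auto
  then obtain n0 where n0: "\<And>n. n \<ge> n0 \<Longrightarrow> (1 / r) ^ n + c * (real n / r ^ n) < 1"
    by (auto simp: eventually_sequentially)
  \<comment> \<open>The hypothesis covers only exponents that are powers of two;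
    \<open>2 ^ n0\<close> is one of them beyond the threshold.\<close>
  have "n0 \<le> 2 ^ n0"
    by (simp add: less_imp_le)
  from n0[OF this] r have "1 + c * 2 ^ n0 < r ^ 2 ^ n0"
    by (simp add: field_simps)
  with assms[of n0] show False
    by (simp add: mult.commute)
qed

section \<open>Arithmetic and norm identities from the axioms\<close>

context unital_cstar_algebra
begin

lemma scale_zero_right [simp]: "c \<odot> \<zero> = \<zero>"
  using norm_scale[of \<zero> c] norm_eq_zero[of \<zero>] norm_eq_zero[of "c \<odot> \<zero>"]
  by (simp add: scale_closed)

lemma scale_zero_left [simp]:
  assumes "x \<in> carrier A"
  shows "0 \<odot> x = \<zero>"
  using norm_scale[OF assms, of 0] norm_eq_zero scale_closed[OF assms] by simp

lemma a_inv_eq_scale: "x \<in> carrier A \<Longrightarrow> \<ominus> x = (-1) \<odot> x"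
  using scale_add_left[of x "-1" 1] scale_closed[of x "-1"]
  by (intro minus_equality) (simp_all add: scale_one)

lemma scale_a_inv: "x \<in> carrier A \<Longrightarrow> c \<odot> (\<ominus> x) = \<ominus> (c \<odot> x)"
  by (simp add: a_inv_eq_scale scale_closed flip: scale_scale)

lemma minus_scale: "x \<in> carrier A \<Longrightarrow> (- c) \<odot> x = \<ominus> (c \<odot> x)"
  by (simp add: a_inv_eq_scale scale_closed flip: scale_scale)

lemma star_zero [simp]: "star A \<zero> = \<zero>"
  using star_scale[of \<zero> 0] by (simp add: star_closed)

lemma star_one [simp]: "star A \<one> = \<one>"
  using star_mult[of "star A \<one>" \<one>] by (simp add: star_closed star_star)

lemma star_a_inv: "x \<in> carrier A \<Longrightarrow> star A (\<ominus> x) = \<ominus> star A x"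
  by (simp add: a_inv_eq_scale star_scale star_closed)

lemma star_diff:
  "\<lbrakk>x \<in> carrier A; y \<in> carrier A\<rbrakk> \<Longrightarrow> star A (x \<ominus> y) = star A x \<ominus> star A y"
  by (simp add: minus_eq star_add star_a_inv)

lemma norm_zero [simp]: "cnorm A \<zero> = 0"
  by (simp add: norm_eq_zero)

lemma norm_a_inv [simp]: "x \<in> carrier A \<Longrightarrow> cnorm A (\<ominus> x) = cnorm A x"
  by (simp add: a_inv_eq_scale norm_scale)

lemma norm_diff_le:
  "\<lbrakk>x \<in> carrier A; y \<in> carrier A\<rbrakk> \<Longrightarrow> cnorm A (x \<ominus> y) \<le> cnorm A x + cnorm A y"
  using norm_triangle[of x "\<ominus> y"] by (simp add: minus_eq)

lemma diff_self [simp]: "x \<in> carrier A \<Longrightarrow> x \<ominus> x = \<zero>"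
  by (simp add: minus_eq r_neg)

lemma diff_swap: "\<lbrakk>x \<in> carrier A; y \<in> carrier A\<rbrakk> \<Longrightarrow> x \<ominus> y = \<ominus> (y \<ominus> x)"
  by (simp add: minus_eq minus_add a_comm)

lemma norm_diff_commute:
  "\<lbrakk>x \<in> carrier A; y \<in> carrier A\<rbrakk> \<Longrightarrow> cnorm A (x \<ominus> y) = cnorm A (y \<ominus> x)"
  by (subst diff_swap) auto

lemma diff_add_diff:
  "\<lbrakk>x \<in> carrier A; y \<in> carrier A; z \<in> carrier A\<rbrakk> \<Longrightarrow> (x \<ominus> y) \<oplus> (y \<ominus> z) = x \<ominus> z"
  by (simp add: minus_eq a_assoc r_neg1)

lemma diff_diff_self: "\<lbrakk>x \<in> carrier A; y \<in> carrier A\<rbrakk> \<Longrightarrow> x \<ominus> (x \<ominus> y) = y"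
  by (simp add: minus_eq minus_add r_neg2)

lemma add_minus_cancel:
  assumes "x \<in> carrier A" "y \<in> carrier A" "z \<in> carrier A"
  shows "x \<oplus> (y \<oplus> (z \<oplus> \<ominus> x)) = y \<oplus> z"
proof -
  have "x \<oplus> (y \<oplus> (z \<oplus> \<ominus> x)) = (y \<oplus> z) \<oplus> (x \<oplus> \<ominus> x)"
    using assms by (simp only: a_ac a_inv_closed a_closed)
  thus ?thesis using assms by (simp add: r_neg)
qed

lemma norm_diff_triangle:
  assumes "x \<in> carrier A" "y \<in> carrier A" "z \<in> carrier A"
  shows "cnorm A (x \<ominus> z) \<le> cnorm A (x \<ominus> y) + cnorm A (y \<ominus> z)"
  using norm_triangle[of "x \<ominus> y" "y \<ominus> z"] assms by (simp add: diff_add_diff)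

lemma eq_if_norm_diff_zero:
  assumes "x \<in> carrier A" "y \<in> carrier A" "cnorm A (x \<ominus> y) = 0"
  shows "x = y"
  using assms norm_eq_zero[of "x \<ominus> y"] minus_equality[of x "\<ominus> y"] by (simp add: minus_eq)

lemma diff_mult:
  assumes "x \<in> carrier A" "y \<in> carrier A" "x' \<in> carrier A" "y' \<in> carrier A"
  shows "x \<otimes> y \<ominus> x' \<otimes> y' = x \<otimes> (y \<ominus> y') \<oplus> (x \<ominus> x') \<otimes> y'"
  using assms by (simp add: minus_eq r_distr l_distr r_minus l_minus a_assoc r_neg1)

lemma norm_diff_mult_le:
  assumes "x \<in> carrier A" "y \<in> carrier A" "x' \<in> carrier A" "y' \<in> carrier A"
  shows "cnorm A (x \<otimes> y \<ominus> x' \<otimes> y') \<le>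
           cnorm A x * cnorm A (y \<ominus> y') + cnorm A (x \<ominus> x') * cnorm A y'"
  unfolding diff_mult[OF assms]
  by (intro order.trans[OF norm_triangle] add_mono norm_mult) (use assms in auto)

lemma norm_star [simp]:
  assumes "x \<in> carrier A"
  shows "cnorm A (star A x) = cnorm A x"
proof -
  have *: "cnorm A x \<le> cnorm A (star A x)" if x: "x \<in> carrier A" for x
  proof (cases "cnorm A x = 0")
    case False
    have "cnorm A x * cnorm A x \<le> cnorm A (star A x) * cnorm A x"
      using norm_mult[of "star A x" x] x cstar_identity[OF x]
      by (simp add: star_closed power2_eq_square)
    thus ?thesis using False norm_ge_zero[OF x] by simp
  qed (use norm_ge_zero[of "star A x"] x star_closed in auto)
  from *[OF assms] *[OF star_closed[OF assms]] show ?thesis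
    using assms by (simp add: star_star)
qed

lemma norm_self_adjoint_square:
  "\<lbrakk>x \<in> carrier A; star A x = x\<rbrakk> \<Longrightarrow> cnorm A (x \<otimes> x) = (cnorm A x)\<^sup>2"
  using cstar_identity[of x] by simp

text \<open>The C*-identity squares the norm at each doubling of the exponent. Combined with
  \<open>le_one_if_power_two_powers_le\<close>, it turns linear growth of the powers of a
  self-adjoint element into a norm of at most 1.\<close>

lemma norm_self_adjoint_power:
  assumes x: "x \<in> carrier A" "star A x = x"
  shows "cnorm A (x [^] (2 ^ k :: nat)) = cnorm A x ^ (2 ^ k)"
proof -
  have sa: "star A (x [^] n) = x [^] n" for n :: nat
  proof (induction n)
    case (Suc n)
    have "star A (x [^] Suc n) = x \<otimes> x [^] n"
      using x Suc by (simp add: star_mult)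
    thus ?case using x(1) by (simp only: nat_pow_Suc2)
  qed auto
  show ?thesis
  proof (induction k)
    case (Suc k)
    have "x [^] (2 ^ Suc k :: nat) = x [^] (2 ^ k :: nat) \<otimes> x [^] (2 ^ k :: nat)"
      using x by (simp add: nat_pow_mult mult_2)
    hence "cnorm A (x [^] (2 ^ Suc k :: nat)) = (cnorm A (x [^] (2 ^ k :: nat)))\<^sup>2"
      using x sa by (simp add: norm_self_adjoint_square)
    thus ?case using Suc by (simp add: mult.commute flip: power_mult)
  qed (use x in auto)
qed

lemma norm_power_le:
  assumes "x \<in> carrier A" "cnorm A x \<le> 1" "n > 0"
  shows "cnorm A (x [^] (n :: nat)) \<le> 1"
  using assms(3)
proof (induction n)
  case (Suc n)
  show ?case
  proof (cases "n = 0")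
    case False
    with Suc have "cnorm A (x [^] n) \<le> 1" by simp
    moreover have "cnorm A (x [^] Suc n) \<le> cnorm A (x [^] n) * cnorm A x"
      using assms by (simp add: norm_mult)
    moreover have "\<dots> \<le> 1 * 1"
      using calculation(1) assms norm_ge_zero by (intro mult_mono) auto
    ultimately show ?thesis by simp
  qed (use assms in auto)
qed auto

section \<open>Projections and the norm of the unit\<close>

definition projection :: "'a \<Rightarrow> bool" where
  "projection p \<longleftrightarrow> p \<in> carrier A \<and> star A p = p \<and> p \<otimes> p = p"

lemma norm_projection_le:
  assumes "projection p"
  shows "cnorm A p \<le> 1"
proof -
  have "cnorm A p = (cnorm A p)\<^sup>2"
    using assms norm_self_adjoint_square[of p] by (simp add: projection_def)
  thus ?thesis by (smt (verit) power2_eq_square mult_cancel_right1)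
qed

lemma projection_one: "projection \<one>"
  by (simp add: projection_def)

text \<open>No equality: the axioms admit the zero algebra, whose unit has norm 0.\<close>

lemma norm_one_le: "cnorm A \<one> \<le> 1"
  by (rule norm_projection_le[OF projection_one])

lemma projection_complement:
  assumes "projection p"
  shows "projection (\<one> \<ominus> p)"
  using assms
  by (auto simp: projection_def star_add star_a_inv minus_eq l_distr r_distr l_minus r_minus a_assoc
      r_neg r_neg1 r_neg2 l_neg)

subsection \<open>Square roots and contractivity of *-homomorphisms\<close>

text \<open>
  A square root of \<open>1 - a\<close> has the form \<open>1 - b\<close>, where \<open>b\<close> is the fixed point of the
  contraction \<open>b \<mapsto> (a + b\<^sup>2) / 2\<close> of the ball of radius \<open>\<parallel>a\<parallel> < 1\<close>.
\<close>

primrec sqrt_iter :: "'a \<Rightarrow> nat \<Rightarrow> 'a" where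
  "sqrt_iter a 0 = \<zero>"
| "sqrt_iter a (Suc n) = (1 / 2) \<odot> (a \<oplus> sqrt_iter a n \<otimes> sqrt_iter a n)"

lemma sqrt_iter_closed [simp]: "a \<in> carrier A \<Longrightarrow> sqrt_iter a n \<in> carrier A"
  by (induction n) (auto simp: scale_closed)

lemma star_sqrt_iter:
  "\<lbrakk>a \<in> carrier A; star A a = a\<rbrakk> \<Longrightarrow> star A (sqrt_iter a n) = sqrt_iter a n"
  by (induction n) (auto simp: star_scale star_add star_mult)

lemma sqrt_iter_commute:
  assumes "a \<in> carrier A" "y \<in> carrier A" "y \<otimes> a = a \<otimes> y"
  shows "y \<otimes> sqrt_iter a n = sqrt_iter a n \<otimes> y"
proof (induction n)
  case (Suc n)
  let ?b = "sqrt_iter a n"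
  have "y \<otimes> (?b \<otimes> ?b) = ?b \<otimes> ?b \<otimes> y"
    using Suc assms by (metis m_assoc sqrt_iter_closed)
  thus ?case
    using assms by (simp add: scale_mult_left scale_mult_right l_distr r_distr)
qed (use assms in auto)

lemma norm_sqrt_iter_le:
  assumes "a \<in> carrier A" "cnorm A a < 1"
  shows "cnorm A (sqrt_iter a n) \<le> cnorm A a"
proof (induction n)
  case (Suc n)
  let ?b = "sqrt_iter a n"
  have "cnorm A (?b \<otimes> ?b) \<le> cnorm A ?b * cnorm A ?b"
    using assms by (simp add: norm_mult)
  also have "\<dots> \<le> cnorm A a * 1"
    using Suc assms by (intro mult_mono) (auto intro: norm_ge_zero)
  finally show ?case
    using norm_triangle[of a "?b \<otimes> ?b"] assms by (simp add: norm_scale)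
qed (use assms norm_ge_zero in auto)

text \<open>By b b - c c = b (b - c) + (b - c) c, halved, the iteration has Lipschitz constant r on
  the ball of radius r, where r is the norm of a.\<close>

lemma norm_sqrt_iter_diff_le:
  assumes "a \<in> carrier A" "cnorm A a < 1"
  shows "cnorm A (sqrt_iter a (n + k) \<ominus> sqrt_iter a n) \<le> 2 * cnorm A a ^ n"
proof (induction n)
  case 0
  show ?case
    using norm_sqrt_iter_le[OF assms, of k] assms by (simp add: minus_eq)
next
  case (Suc n)
  let ?b = "sqrt_iter a (n + k)" and ?c = "sqrt_iter a n" and ?r = "cnorm A a"
  have eq: "sqrt_iter a (Suc n + k) \<ominus> sqrt_iter a (Suc n) = (1 / 2) \<odot> (?b \<otimes> ?b \<ominus> ?c \<otimes> ?c)"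
    using assms
    by (simp add: minus_eq scale_add_right scale_a_inv minus_add scale_closed a_ac r_neg2)
  have "cnorm A (?b \<otimes> ?b \<ominus> ?c \<otimes> ?c) \<le>
      cnorm A ?b * cnorm A (?b \<ominus> ?c) + cnorm A (?b \<ominus> ?c) * cnorm A ?c"
    using assms by (intro norm_diff_mult_le) auto
  also have "\<dots> \<le> ?r * (2 * ?r ^ n) + (2 * ?r ^ n) * ?r"
    using Suc assms norm_sqrt_iter_le[OF assms]
    by (intro add_mono mult_mono) (auto intro: norm_ge_zero zero_le_power)
  finally show ?case
    unfolding eq using assms by (simp add: norm_scale)
qed

lemma eq_if_norm_diff_le:
  assumes "x \<in> carrier A" "y \<in> carrier A" "e \<longlonglongrightarrow> 0"
    and "\<And>n :: nat. cnorm A (x \<ominus> y) \<le> C * e n"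
  shows "x = y"
proof (rule eq_if_norm_diff_zero)
  have "(\<lambda>n. C * e n) \<longlonglongrightarrow> C * 0"
    by (intro tendsto_intros assms)
  hence "cnorm A (x \<ominus> y) \<le> 0"
    using assms(4) by (intro LIMSEQ_le_const) auto
  thus "cnorm A (x \<ominus> y) = 0"
    using norm_ge_zero[of "x \<ominus> y"] assms by simp
qed (use assms in auto)

text \<open>The last clause makes square roots of commuting elements commute, so that two of them
  can serve as real and imaginary part of a normal element in
  \<open>norm_le_if_sum_squares_eq\<close>.\<close>

lemma exists_sqrt_one_minus:
  assumes a: "a \<in> carrier A" "star A a = a" "cnorm A a < 1"
  shows "\<exists>c \<in> carrier A. star A c = c \<and> c \<otimes> c = \<one> \<ominus> a \<and>
           (\<forall>y \<in> carrier A. y \<otimes> a = a \<otimes> y \<longrightarrow> y \<otimes> c = c \<otimes> y)"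
proof -
  define f where "f = sqrt_iter a"
  define r where "r = cnorm A a"
  have r: "0 \<le> r" "r < 1"
    using a norm_ge_zero by (auto simp: r_def)
  have f [simp]: "f n \<in> carrier A" for n
    using a by (simp add: f_def)
  have lim: "(\<lambda>n. 2 * r ^ n) \<longlonglongrightarrow> 0"
    using tendsto_mult[OF tendsto_const LIMSEQ_realpow_zero[OF r], of 2] by simp
  have diff: "cnorm A (f m \<ominus> f n) \<le> 2 * r ^ n" if "m \<ge> n" for m n
    using norm_sqrt_iter_diff_le[OF a(1,3), of n "m - n"] that by (simp add: f_def r_def)
  have cauchy: "\<exists>n0. \<forall>m\<ge>n0. \<forall>n\<ge>n0. cnorm A (f m \<ominus> f n) < e" if e: "e > 0" for e
  proof -
    from order_tendstoD(2)[OF lim e] obtain n0 where n0: "\<And>n. n \<ge> n0 \<Longrightarrow> 2 * r ^ n < e"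
      by (auto simp: eventually_sequentially)
    have "cnorm A (f m \<ominus> f n) < e" if "m \<ge> n0" "n \<ge> n0" for m n
    proof (cases "m \<ge> n")
      case True
      thus ?thesis using diff[of n m] n0[of n] that by linarith
    next
      case False
      thus ?thesis using diff[of m n] n0[of m] that norm_diff_commute[of "f m" "f n"] by simp
    qed
    thus ?thesis by blast
  qed
  obtain b where b: "b \<in> carrier A" "(\<lambda>n. cnorm A (f n \<ominus> b)) \<longlonglongrightarrow> 0"
    using complete[OF f cauchy] by blast
  \<comment> \<open>Two consecutive distances are added because the fixed point equation compares
    \<open>f n\<close> with \<open>f (Suc n)\<close>.\<close>
  define e where "e = (\<lambda>n. cnorm A (f n \<ominus> b) + cnorm A (f (Suc n) \<ominus> b))"
  have e: "e \<longlonglongrightarrow> 0"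
    unfolding e_def using tendsto_add[OF b(2) LIMSEQ_Suc[OF b(2)]] by simp
  have e_le: "cnorm A (f n \<ominus> b) \<le> e n" for n
    using b norm_ge_zero[of "f (Suc n) \<ominus> b"] by (simp add: e_def)
  have star_b: "star A b = b"
  proof (rule eq_if_norm_diff_le[OF _ _ e])
    fix n
    have "star A (f n \<ominus> b) = f n \<ominus> star A b"
      using a b by (simp add: star_diff f_def star_sqrt_iter)
    hence "cnorm A (star A b \<ominus> f n) = cnorm A (f n \<ominus> b)"
      using b norm_star[of "f n \<ominus> b"] by (simp add: norm_diff_commute star_closed)
    thus "cnorm A (star A b \<ominus> b) \<le> 2 * e n"
      using norm_diff_triangle[of "star A b" "f n" b] e_le[of n] b
      by (simp add: star_closed)
  qed (use b star_closed in auto)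
  have comm: "y \<otimes> b = b \<otimes> y" if y: "y \<in> carrier A" "y \<otimes> a = a \<otimes> y" for y
  proof (rule eq_if_norm_diff_le[OF _ _ e])
    fix n
    have "cnorm A (y \<otimes> b \<ominus> y \<otimes> f n) \<le> cnorm A y * e n"
      using norm_diff_mult_le[of y b y "f n"] y b e_le[of n]
        mult_left_mono[OF e_le norm_ge_zero, of y n]
      by (simp add: norm_diff_commute[of "f n" b])
    moreover have "cnorm A (f n \<otimes> y \<ominus> b \<otimes> y) \<le> cnorm A y * e n"
      using norm_diff_mult_le[of "f n" y b y] y b
        mult_left_mono[OF e_le norm_ge_zero, of y n]
      by (simp add: mult.commute)
    moreover have "y \<otimes> f n = f n \<otimes> y"
      using sqrt_iter_commute[of a y n] a y by (simp add: f_def)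
    ultimately show "cnorm A (y \<otimes> b \<ominus> b \<otimes> y) \<le> (2 * cnorm A y) * e n"
      using norm_diff_triangle[of "y \<otimes> b" "y \<otimes> f n" "b \<otimes> y"] y b by simp
  qed (use b y in auto)
  have fixpoint: "(1 / 2) \<odot> (a \<oplus> b \<otimes> b) = b"
  proof (rule eq_if_norm_diff_le[OF _ _ e])
    fix n
    have "(1 / 2) \<odot> (a \<oplus> b \<otimes> b) \<ominus> f (Suc n) = (1 / 2) \<odot> (b \<otimes> b \<ominus> f n \<otimes> f n)"
      using a b f[of n, unfolded f_def]
      by (simp add: f_def minus_eq scale_add_right scale_a_inv minus_add scale_closed a_ac r_neg2)
    hence "cnorm A ((1 / 2) \<odot> (a \<oplus> b \<otimes> b) \<ominus> f (Suc n)) \<le> cnorm A (b \<otimes> b \<ominus> f n \<otimes> f n)"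
      using b norm_ge_zero[of "b \<otimes> b \<ominus> f n \<otimes> f n"] by (simp add: norm_scale)
    also have "\<dots> \<le> cnorm A b * cnorm A (b \<ominus> f n) + cnorm A (b \<ominus> f n) * cnorm A (f n)"
      using b by (intro norm_diff_mult_le) auto
    also have "\<dots> \<le> cnorm A b * e n + e n * 1"
    proof (intro add_mono mult_mono)
      show "cnorm A (f n) \<le> 1"
        using norm_sqrt_iter_le[OF a(1,3), of n] a by (simp add: f_def)
      show "0 \<le> e n"
        using order.trans[OF norm_ge_zero e_le] b by simp
    qed (use b e_le[of n] in \<open>auto intro: norm_ge_zero simp: norm_diff_commute[of b]\<close>)
    finally have "cnorm A ((1 / 2) \<odot> (a \<oplus> b \<otimes> b) \<ominus> f (Suc n)) \<le> (cnorm A b + 1) * e n"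
      by (simp add: algebra_simps)
    moreover have "cnorm A (f (Suc n) \<ominus> b) \<le> e n"
      using b norm_ge_zero[of "f n \<ominus> b"] by (simp add: e_def)
    ultimately show "cnorm A ((1 / 2) \<odot> (a \<oplus> b \<otimes> b) \<ominus> b) \<le> (cnorm A b + 2) * e n"
      using norm_diff_triangle[of "(1 / 2) \<odot> (a \<oplus> b \<otimes> b)" "f (Suc n)" b] a b
      by (simp add: scale_closed algebra_simps)
  qed (use a b scale_closed in auto)
  \<comment> \<open>Doubled, the fixed point equation reads b b = 2 b - a, which is (1 - b)(1 - b) =
    1 - a.\<close>
  have "2 \<odot> ((1 / 2) \<odot> (a \<oplus> b \<otimes> b)) = 2 \<odot> b"
    by (simp only: fixpoint)
  hence "a \<oplus> b \<otimes> b = b \<oplus> b"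
    using a b scale_add_left[of b 1 1] by (simp add: scale_one flip: scale_scale)
  hence bb: "b \<otimes> b = b \<oplus> b \<ominus> a"
    using a b by (metis a_comm add.inv_solve_right m_closed minus_eq a_closed)
  have "(\<one> \<ominus> b) \<otimes> (\<one> \<ominus> b) = \<one> \<ominus> a"
    using a b add_minus_cancel[of b "\<one>" "\<ominus> a"]
    by (simp add: minus_eq l_distr r_distr l_minus r_minus bb minus_add a_ac r_neg r_neg1 r_neg2)
  moreover have "y \<otimes> (\<one> \<ominus> b) = (\<one> \<ominus> b) \<otimes> y" if "y \<in> carrier A" "y \<otimes> a = a \<otimes> y" for y
    using that b comm[OF that] by (simp add: minus_eq l_distr r_distr l_minus r_minus)
  ultimately show ?thesis
    using b star_b by (intro bexI[of _ "\<one> \<ominus> b"]) (auto simp: star_diff)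
qed

text \<open>Since c and d commute, v = c + i d satisfies v* v = c c + d d = s 1, so its squared norm
  is at most s; and d, the imaginary part of v, is no longer than v.\<close>

lemma norm_le_if_sum_squares_eq:
  assumes "c \<in> carrier A" "d \<in> carrier A" "star A c = c" "star A d = d" "c \<otimes> d = d \<otimes> c"
    and eq: "c \<otimes> c \<oplus> d \<otimes> d = complex_of_real s \<odot> \<one>" and "0 \<le> s"
  shows "(cnorm A d)\<^sup>2 \<le> s"
proof -
  define v where "v = c \<oplus> \<i> \<odot> d"
  have v: "v \<in> carrier A" "star A v = c \<ominus> \<i> \<odot> d"
    using assms by (simp_all add: v_def scale_closed star_add star_scale minus_eq minus_scale)
  have "star A v \<otimes> v = c \<otimes> c \<oplus> d \<otimes> d"
    using assms
    by (simp add: v(2), simp add: v_def scale_closed minus_eq l_distr r_distr l_minus r_minus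
        scale_mult_left scale_mult_right minus_scale scale_one scale_add_right scale_a_inv a_ac r_neg r_neg2
        flip: scale_scale)
  hence "(cnorm A v)\<^sup>2 \<le> s"
    using cstar_identity[OF v(1)] mult_left_mono[OF norm_one_le \<open>0 \<le> s\<close>] \<open>0 \<le> s\<close>
    by (simp add: eq norm_scale)
  moreover have "(2 * \<i>) \<odot> d = v \<ominus> star A v"
    using assms scale_add_left[of d \<i> \<i>]
    by (simp add: v(2), simp add: v_def scale_closed minus_eq minus_add a_ac r_neg2)
  hence "2 * cnorm A d \<le> cnorm A v + cnorm A v"
    using norm_diff_le[of v "star A v"] v(1) assms norm_scale[of d "2 * \<i>"]
    by (simp add: star_closed norm_mult)
  hence "(cnorm A d)\<^sup>2 \<le> (cnorm A v)\<^sup>2"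
    using assms norm_ge_zero by (intro power_mono) auto
  ultimately show ?thesis by simp
qed

end

text \<open>
  A self-adjoint element \<open>a\<close> of norm less than \<open>1\<close> is the imaginary part of the unitary
  \<open>\<surd>(1 - a\<^sup>2) + i a\<close>, and unitaries are mapped to unitaries.
\<close>

lemma star_hom_norm_le:
  assumes "unital_cstar_algebra A" "unital_cstar_algebra B" "star_hom A B h" "x \<in> carrier A"
  shows "cnorm B (h x) \<le> cnorm A x"
proof -
  interpret A: unital_cstar_algebra A by fact
  interpret B: unital_cstar_algebra B by fact
  have h: "h \<in> ring_hom A B" and
    h_star: "\<And>x. x \<in> carrier A \<Longrightarrow> h (star A x) = star B (h x)" and
    h_scale: "\<And>x c. x \<in> carrier A \<Longrightarrow> h (c \<odot>\<^bsub>A\<^esub> x) = c \<odot>\<^bsub>B\<^esub> h x"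
    using assms(3) by (auto simp: star_hom_def)
  note h_simps = ring_hom_closed[OF h] ring_hom_add[OF h] ring_hom_mult[OF h] ring_hom_one[OF h]
    h_star[symmetric] h_scale
  have less_1: "cnorm B (h a) \<le> 1"
    if a: "a \<in> carrier A" "star A a = a" "cnorm A a < 1" for a
  proof -
    have "cnorm A (a \<otimes>\<^bsub>A\<^esub> a) < 1"
      using a A.norm_ge_zero[of a] by (simp add: A.norm_self_adjoint_square power_less_one_iff)
    with a obtain c where c: "c \<in> carrier A" "star A c = c"
        "c \<otimes>\<^bsub>A\<^esub> c = \<one>\<^bsub>A\<^esub> \<ominus>\<^bsub>A\<^esub> a \<otimes>\<^bsub>A\<^esub> a" "a \<otimes>\<^bsub>A\<^esub> c = c \<otimes>\<^bsub>A\<^esub> a"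
      using A.exists_sqrt_one_minus[of "a \<otimes>\<^bsub>A\<^esub> a"] by (auto simp: A.star_mult A.m_assoc)
    have "c \<otimes>\<^bsub>A\<^esub> c \<oplus>\<^bsub>A\<^esub> a \<otimes>\<^bsub>A\<^esub> a = \<one>\<^bsub>A\<^esub>"
      using a c by (simp add: A.minus_eq A.a_assoc A.l_neg)
    hence "h (c \<otimes>\<^bsub>A\<^esub> c \<oplus>\<^bsub>A\<^esub> a \<otimes>\<^bsub>A\<^esub> a) = \<one>\<^bsub>B\<^esub>"
      by (simp add: ring_hom_one[OF h])
    hence "h c \<otimes>\<^bsub>B\<^esub> h c \<oplus>\<^bsub>B\<^esub> h a \<otimes>\<^bsub>B\<^esub> h a = complex_of_real 1 \<odot>\<^bsub>B\<^esub> \<one>\<^bsub>B\<^esub>"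
      using a c(1,2) by (simp add: B.scale_one ring_hom_add[OF h] ring_hom_mult[OF h])
    moreover have "h c \<otimes>\<^bsub>B\<^esub> h a = h a \<otimes>\<^bsub>B\<^esub> h c"
      using a c by (simp flip: ring_hom_mult[OF h])
    ultimately have "(cnorm B (h a))\<^sup>2 \<le> 1"
      using a c by (intro B.norm_le_if_sum_squares_eq[of "h c"]) (auto simp: h_simps)
    thus ?thesis by (simp add: abs_square_le_1)
  qed
  have self_adjoint: "cnorm B (h a) \<le> cnorm A a" if a: "a \<in> carrier A" "star A a = a" for a
  proof (rule field_le_epsilon)
    fix e :: real assume "e > 0"
    \<comment> \<open>Square roots are available only for norms strictly below 1, so
      \<open>a\<close> is divided by a number slightly above its norm.\<close>
    define r where "r = cnorm A a + e"
    have r: "r > 0" "cnorm A a < r"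
      using \<open>e > 0\<close> A.norm_ge_zero[OF a(1)] by (auto simp: r_def)
    let ?a = "complex_of_real (1 / r) \<odot>\<^bsub>A\<^esub> a"
    have "cnorm B (h ?a) \<le> 1"
      using a r by (intro less_1) (auto simp: A.scale_closed A.star_scale A.norm_scale norm_divide)
    hence "cnorm B (h a) \<le> r"
      using a r by (simp add: h_scale B.norm_scale ring_hom_closed[OF h] norm_divide)
    thus "cnorm B (h a) \<le> cnorm A a + e"
      by (simp add: r_def)
  qed
  have "(cnorm B (h x))\<^sup>2 = cnorm B (h (star A x \<otimes>\<^bsub>A\<^esub> x))"
    using assms(4) by (simp add: ring_hom_mult[OF h] A.star_closed h_star ring_hom_closed[OF h]
        B.cstar_identity)
  also have "\<dots> \<le> cnorm A (star A x \<otimes>\<^bsub>A\<^esub> x)"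
    using assms(4) by (intro self_adjoint) (auto simp: A.star_closed A.star_mult A.star_star)
  also have "\<dots> = (cnorm A x)\<^sup>2"
    using assms(4) by (simp add: A.cstar_identity)
  finally show ?thesis
    using A.norm_ge_zero[OF assms(4)] by (rule power2_le_imp_le)
qed

subsection \<open>Orthogonality of projections\<close>

context unital_cstar_algebra
begin

text \<open>
  By \<open>(1 + x x\<^sup>*)\<^sup>n = 1 + x g x\<^sup>*\<close> with \<open>g = \<Sum>\<^bsub>k < n\<^esub> (1 + x\<^sup>* x)\<^sup>k\<close>, the powers of
  \<open>1 + x x\<^sup>*\<close> grow only linearly in norm.
\<close>

lemma norm_one_plus_swap:
  assumes x: "x \<in> carrier A" and le: "cnorm A (\<one> \<oplus> star A x \<otimes> x) \<le> 1"
  shows "cnorm A (\<one> \<oplus> x \<otimes> star A x) \<le> 1"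
proof -
  define c where "c = \<one> \<oplus> star A x \<otimes> x"
  define d where "d = \<one> \<oplus> x \<otimes> star A x"
  have [simp]: "x \<in> carrier A" "star A x \<in> carrier A" "c \<in> carrier A" "d \<in> carrier A"
    using x by (auto simp: c_def d_def star_closed)
  have swap: "d \<otimes> x = x \<otimes> c"
    by (simp add: c_def d_def l_distr r_distr m_assoc)
  \<comment> \<open>By d x = x c, multiplication by d replaces g by 1 + c g; as c has norm at most
    1, the bound for g grows by one at each step.\<close>
  have pow: "\<exists>g \<in> carrier A. cnorm A g \<le> real n \<and> d [^] n = \<one> \<oplus> x \<otimes> g \<otimes> star A x" for n :: nat
  proof (induction n)
    case 0
    show ?case by (intro bexI[of _ \<zero>]) auto
  next
    case (Suc n)
    then obtain g where g: "g \<in> carrier A" "cnorm A g \<le> real n"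
        "d [^] n = \<one> \<oplus> x \<otimes> g \<otimes> star A x"
      by blast
    have "d [^] Suc n = d \<otimes> d [^] n"
      by (rule nat_pow_Suc2) simp
    also have "\<dots> = d \<oplus> d \<otimes> x \<otimes> g \<otimes> star A x"
      using g by (simp add: r_distr m_assoc)
    also have "\<dots> = \<one> \<oplus> x \<otimes> (\<one> \<oplus> c \<otimes> g) \<otimes> star A x"
      using g by (simp only: swap) (simp add: d_def r_distr l_distr m_assoc a_assoc)
    finally have "d [^] Suc n = \<one> \<oplus> x \<otimes> (\<one> \<oplus> c \<otimes> g) \<otimes> star A x" .
    moreover have "cnorm A (c \<otimes> g) \<le> 1 * real n"
      using g le norm_ge_zero
      by (intro order.trans[OF norm_mult] mult_mono) (auto simp: c_def)
    hence "cnorm A (\<one> \<oplus> c \<otimes> g) \<le> real (Suc n)"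
      using norm_triangle[of \<one> "c \<otimes> g"] norm_one_le g by simp
    ultimately show ?case
      using g by (intro bexI[of _ "\<one> \<oplus> c \<otimes> g"]) auto
  qed
  have "cnorm A d \<le> 1"
  proof (rule le_one_if_power_two_powers_le)
    fix k :: nat
    obtain g where g: "g \<in> carrier A" "cnorm A g \<le> real (2 ^ k)"
        "d [^] (2 ^ k :: nat) = \<one> \<oplus> x \<otimes> g \<otimes> star A x"
      using pow by blast
    have "cnorm A (x \<otimes> g \<otimes> star A x) \<le> cnorm A x * real (2 ^ k) * cnorm A x"
      using g norm_ge_zero
      by (intro order.trans[OF norm_mult] mult_mono) auto
    hence "cnorm A (\<one> \<oplus> x \<otimes> g \<otimes> star A x) \<le> 1 + cnorm A x * real (2 ^ k) * cnorm A x"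
      using norm_triangle[of \<one> "x \<otimes> g \<otimes> star A x"] norm_one_le g by simp
    moreover have "cnorm A (d [^] (2 ^ k :: nat)) = cnorm A d ^ 2 ^ k"
      by (rule norm_self_adjoint_power) (auto simp: d_def star_add star_mult star_star)
    ultimately show "cnorm A d ^ 2 ^ k \<le> 1 + 2 ^ k * (cnorm A x * cnorm A x)"
      using g by (simp add: mult_ac)
  qed
  thus ?thesis by (simp add: d_def)
qed

text \<open>This is positivity of a square in norm form, a form that adds up by the triangle
  inequality. After rescaling to a' of norm below 1, a' a' + c c = 1 for a self-adjoint c commuting
  with a'; hence c, and with it 1 - a' a' = c c, has norm at most 1.\<close>

lemma norm_scalar_minus_square_le:
  assumes a: "a \<in> carrier A" "star A a = a"
  shows "\<exists>t \<ge> 0. cnorm A (complex_of_real t \<odot> \<one> \<ominus> a \<otimes> a) \<le> t"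
proof -
  define r where "r = cnorm A a + 1"
  have r: "r > 0" "cnorm A a < r"
    using norm_ge_zero[OF a(1)] by (auto simp: r_def)
  define a' where "a' = complex_of_real (1 / r) \<odot> a"
  have a': "a' \<in> carrier A" "star A a' = a'" "cnorm A a' < 1"
    using a r by (auto simp: a'_def scale_closed star_scale norm_scale norm_divide)
  have "cnorm A (a' \<otimes> a') < 1"
    using a' norm_ge_zero[of a'] by (simp add: norm_self_adjoint_square power_less_one_iff)
  with a' obtain c where c: "c \<in> carrier A" "star A c = c"
      "c \<otimes> c = \<one> \<ominus> a' \<otimes> a'" "a' \<otimes> c = c \<otimes> a'"
    using exists_sqrt_one_minus[of "a' \<otimes> a'"] by (auto simp: star_mult m_assoc)
  have "a' \<otimes> a' \<oplus> c \<otimes> c = complex_of_real 1 \<odot> \<one>"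
    using a' c by (simp add: minus_eq a_ac r_neg r_neg1 scale_one)
  hence "(cnorm A c)\<^sup>2 \<le> 1"
    using a' c by (intro norm_le_if_sum_squares_eq[of a']) auto
  hence le: "cnorm A (\<one> \<ominus> a' \<otimes> a') \<le> 1"
    using c norm_self_adjoint_square[of c] by simp
  have "complex_of_real (r\<^sup>2) \<odot> (\<one> \<ominus> a' \<otimes> a') = complex_of_real (r\<^sup>2) \<odot> \<one> \<ominus> a \<otimes> a"
    using a r
    by (simp add: a'_def minus_eq scale_add_right scale_closed scale_mult_left scale_mult_right
        scale_a_inv scale_one power2_eq_square flip: scale_scale)
  hence "cnorm A (complex_of_real (r\<^sup>2) \<odot> \<one> \<ominus> a \<otimes> a) \<le> r\<^sup>2"
    using le a' norm_scale[of "\<one> \<ominus> a' \<otimes> a'" "complex_of_real (r\<^sup>2)"]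
    by (simp add: mult_left_le norm_power)
  thus ?thesis by (intro exI[of _ "r\<^sup>2"]) auto
qed

text \<open>Dividing t 1 - a and t 1 + a by s = t + e gives commuting p and q of norm below 1. The
  squares 1 - p and 1 - q add up to the small scalar 2 e / s, which therefore bounds the norm of 1 -
  q. As s (1 - q) = e 1 - a, the element a has norm at most 2 e + e for every e > 0.\<close>

lemma zero_if_positive_negative:
  assumes a: "a \<in> carrier A" "star A a = a" and t: "0 \<le> t"
    and minus: "cnorm A (complex_of_real t \<odot> \<one> \<ominus> a) \<le> t"
    and plus: "cnorm A (complex_of_real t \<odot> \<one> \<oplus> a) \<le> t"
  shows "a = \<zero>"
proof -
  have "cnorm A a \<le> 0 + 3 * e" if e: "e > 0" for e
  proof -
    define s where "s = t + e"
    have s: "s > 0" "t < s"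
      using t e by (auto simp: s_def)
    define p where "p = complex_of_real (1 / s) \<odot> (complex_of_real t \<odot> \<one> \<ominus> a)"
    define q where "q = complex_of_real (1 / s) \<odot> (complex_of_real t \<odot> \<one> \<oplus> a)"
    have p: "p \<in> carrier A" "star A p = p" "cnorm A p < 1"
      using a s minus by (auto simp: p_def scale_closed star_scale star_diff norm_scale norm_divide)
    have q: "q \<in> carrier A" "star A q = q" "cnorm A q < 1"
      using a s plus by (auto simp: q_def scale_closed star_scale star_add norm_scale norm_divide)
    have pq: "p \<otimes> q = q \<otimes> p"
      using a by (simp add: p_def q_def minus_eq scale_closed l_distr r_distr l_minus r_minus
          scale_mult_left scale_mult_right scale_add_right scale_a_inv minus_add flip: scale_scale)
        (simp add: scale_closed a_ac mult_ac)
    obtain c where c: "c \<in> carrier A" "star A c = c" "c \<otimes> c = \<one> \<ominus> p"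
        "\<And>y. \<lbrakk>y \<in> carrier A; y \<otimes> p = p \<otimes> y\<rbrakk> \<Longrightarrow> y \<otimes> c = c \<otimes> y"
      using exists_sqrt_one_minus[OF p] by blast
    obtain d where d: "d \<in> carrier A" "star A d = d" "d \<otimes> d = \<one> \<ominus> q"
        "\<And>y. \<lbrakk>y \<in> carrier A; y \<otimes> q = q \<otimes> y\<rbrakk> \<Longrightarrow> y \<otimes> d = d \<otimes> y"
      using exists_sqrt_one_minus[OF q] by blast
    have cd: "c \<otimes> d = d \<otimes> c"
      using c(4)[OF d(1)] d(4)[OF p(1) pq] by simp
    have "p \<oplus> q = complex_of_real (2 * t / s) \<odot> \<one>"
      using a scale_add_left[of \<one> "complex_of_real (t / s)" "complex_of_real (t / s)"]
      by (simp add: p_def q_def minus_eq scale_add_right scale_closed scale_a_inv a_ac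
          add_minus_cancel flip: scale_scale)
    moreover have "c \<otimes> c \<oplus> d \<otimes> d = (\<one> \<oplus> \<one>) \<ominus> (p \<oplus> q)"
      using p q by (simp add: c d minus_eq minus_add a_ac)
    moreover have "\<one> \<oplus> \<one> = 2 \<odot> \<one>"
      using scale_add_left[of \<one> 1 1] by (simp add: scale_one)
    ultimately have "c \<otimes> c \<oplus> d \<otimes> d = (2 + - complex_of_real (2 * t / s)) \<odot> \<one>"
      by (simp only: scale_add_left[OF one_closed] minus_scale[OF one_closed] minus_eq)
    also have "2 + - complex_of_real (2 * t / s) = complex_of_real (2 - 2 * t / s)"
      by simp
    also have "2 - 2 * t / s = 2 * e / s"
      using s by (simp add: s_def field_simps)
    finally have "(cnorm A d)\<^sup>2 \<le> 2 * e / s"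
      using c d cd s e by (intro norm_le_if_sum_squares_eq[of c]) auto
    hence "cnorm A (\<one> \<ominus> q) \<le> 2 * e / s"
      using d norm_self_adjoint_square[of d] by simp
    moreover have s_add: "complex_of_real s \<odot> \<one> = complex_of_real t \<odot> \<one> \<oplus> complex_of_real e \<odot> \<one>"
      using scale_add_left[of \<one> "complex_of_real t" "complex_of_real e"] by (simp add: s_def)
    have "complex_of_real s \<odot> q = complex_of_real t \<odot> \<one> \<oplus> a"
      using a s by (simp add: q_def scale_closed scale_one flip: scale_scale)
    hence "complex_of_real s \<odot> (\<one> \<ominus> q) =
        (complex_of_real t \<odot> \<one> \<oplus> complex_of_real e \<odot> \<one>) \<ominus> (complex_of_real t \<odot> \<one> \<oplus> a)"
      using q by (simp add: s_add minus_eq scale_add_right scale_a_inv)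
    hence "complex_of_real s \<odot> (\<one> \<ominus> q) = complex_of_real e \<odot> \<one> \<ominus> a"
      using a by (simp add: minus_eq minus_add scale_closed a_ac r_neg r_neg1 r_neg2 add_minus_cancel)
    hence "cnorm A (complex_of_real e \<odot> \<one> \<ominus> a) = s * cnorm A (\<one> \<ominus> q)"
      using norm_scale[of "\<one> \<ominus> q" "complex_of_real s"] q s by simp
    ultimately have "cnorm A (complex_of_real e \<odot> \<one> \<ominus> a) \<le> 2 * e"
      using s by (simp add: field_simps)
    moreover have "cnorm A (complex_of_real e \<odot> \<one>) \<le> e"
      using e norm_one_le by (simp add: norm_scale mult_left_le)
    moreover have "a = complex_of_real e \<odot> \<one> \<ominus> (complex_of_real e \<odot> \<one> \<ominus> a)"
      using a by (simp add: diff_diff_self scale_closed)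
    ultimately show ?thesis
      using norm_diff_le[of "complex_of_real e \<odot> \<one>" "complex_of_real e \<odot> \<one> \<ominus> a"] a
      by (simp add: scale_closed)
  qed
  hence "cnorm A a \<le> 0 + e" if "e > 0" for e
    using that by (metis divide_pos_pos nonzero_mult_div_cancel_left times_divide_eq_right
        zero_less_numeral zero_neq_numeral)
  hence "cnorm A a \<le> 0"
    by (rule field_le_epsilon)
  thus ?thesis
    using norm_ge_zero[OF a(1)] norm_eq_zero[OF a(1)] by simp
qed

text \<open>
  Here \<open>y y\<^sup>* \<le> 0\<close> by the swap, while \<open>2 (y\<^sup>* y + y y\<^sup>*)\<close> is a sum of squares of
  self-adjoint elements, so that \<open>y\<^sup>* y\<close> is both positive and negative.
\<close>

lemma zero_if_norm_one_plus_star_self_le: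
  assumes y: "y \<in> carrier A" and le: "cnorm A (\<one> \<oplus> star A y \<otimes> y) \<le> 1"
  shows "y = \<zero>"
proof -
  have [simp]: "y \<in> carrier A" "star A y \<in> carrier A" "star A (star A y) = y"
    using y by (auto simp: star_closed star_star)
  \<comment> \<open>Up to sign, h and k are twice the real and imaginary parts of y; in h h + k k
    the terms y y and y* y* cancel.\<close>
  define h where "h = y \<oplus> star A y"
  define k where "k = \<i> \<odot> (y \<ominus> star A y)"
  have h: "h \<in> carrier A" "star A h = h"
    by (auto simp: h_def star_add a_comm)
  have k: "k \<in> carrier A" "star A k = k"
    by (auto simp: k_def minus_eq scale_add_right scale_a_inv scale_closed star_add star_a_inv
        star_scale minus_scale a_comm)
  define w where "w = star A y \<otimes> y \<oplus> y \<otimes> star A y"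
  have w: "w \<in> carrier A"
    by (auto simp: w_def)
  let ?a = "y \<otimes> y" and ?b = "star A y \<otimes> star A y"
  have "k \<otimes> k = \<ominus> ((y \<ominus> star A y) \<otimes> (y \<ominus> star A y))"
    by (simp add: k_def scale_mult_left scale_mult_right minus_scale scale_one scale_closed
        flip: scale_scale)
  hence "h \<otimes> h \<oplus> k \<otimes> k = (?a \<oplus> w \<oplus> ?b) \<oplus> (w \<oplus> \<ominus> ?a \<oplus> \<ominus> ?b)"
    by (simp add: w_def h_def minus_eq l_distr r_distr l_minus r_minus minus_add a_ac)
  also have "\<dots> = (w \<oplus> w) \<oplus> ((?a \<oplus> \<ominus> ?a) \<oplus> (?b \<oplus> \<ominus> ?b))"
    using w by (simp only: a_ac a_inv_closed a_closed m_closed \<open>y \<in> carrier A\<close> \<open>star A y \<in> carrier A\<close>)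
  finally have "w \<oplus> w = h \<otimes> h \<oplus> k \<otimes> k"
    using w by (simp add: r_neg)
  hence w2: "2 \<odot> w = h \<otimes> h \<oplus> k \<otimes> k"
    using w scale_add_left[of w 1 1] by (simp add: scale_one)
  obtain s t where s: "0 \<le> s" "cnorm A (complex_of_real s \<odot> \<one> \<ominus> h \<otimes> h) \<le> s"
    and t: "0 \<le> t" "cnorm A (complex_of_real t \<odot> \<one> \<ominus> k \<otimes> k) \<le> t"
    using norm_scalar_minus_square_le h k by meson
  define r where "r = (s + t) / 2"
  have r2: "2 * complex_of_real r = complex_of_real (s + t)"
    by (simp add: r_def)
  have "2 \<odot> (complex_of_real r \<odot> \<one> \<ominus> w) = complex_of_real (s + t) \<odot> \<one> \<ominus> 2 \<odot> w"
    using w by (simp add: r2 minus_eq scale_add_right scale_a_inv scale_closed flip: scale_scale)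
  also have "\<dots> = (complex_of_real s \<odot> \<one> \<ominus> h \<otimes> h) \<oplus> (complex_of_real t \<odot> \<one> \<ominus> k \<otimes> k)"
    using h k by (simp add: w2 scale_add_left scale_closed minus_eq minus_add a_ac)
  finally have "2 * cnorm A (complex_of_real r \<odot> \<one> \<ominus> w) \<le> s + t"
    using norm_triangle[of "complex_of_real s \<odot> \<one> \<ominus> h \<otimes> h" "complex_of_real t \<odot> \<one> \<ominus> k \<otimes> k"]
      norm_scale[of "complex_of_real r \<odot> \<one> \<ominus> w" 2] s t h k w
    by (simp add: scale_closed)
  hence r: "0 \<le> r" "cnorm A (complex_of_real r \<odot> \<one> \<ominus> w) \<le> r"
    using s t by (auto simp: r_def)
  have "star A y \<otimes> y = \<zero>"
  proof (rule zero_if_positive_negative)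
    \<comment> \<open>The positivity of w bounds the first summand by r, and the swap bounds the
      second by 1: y* y is w minus y y*, a positive element minus a negative one would not do, so
      the bound is taken on the difference from (r + 1) 1.\<close>
    have "complex_of_real (r + 1) \<odot> \<one> \<ominus> star A y \<otimes> y =
        (complex_of_real r \<odot> \<one> \<ominus> w) \<oplus> (\<one> \<oplus> y \<otimes> star A y)"
      by (simp add: w_def scale_add_left scale_one scale_closed minus_eq minus_add a_ac
          r_neg r_neg1 r_neg2 l_neg)
    thus "cnorm A (complex_of_real (r + 1) \<odot> \<one> \<ominus> star A y \<otimes> y) \<le> r + 1"
      using norm_triangle[of "complex_of_real r \<odot> \<one> \<ominus> w" "\<one> \<oplus> y \<otimes> star A y"]
        r norm_one_plus_swap[OF y le] w by (simp add: scale_closed)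
    have "complex_of_real (r + 1) \<odot> \<one> \<oplus> star A y \<otimes> y =
        complex_of_real r \<odot> \<one> \<oplus> (\<one> \<oplus> star A y \<otimes> y)"
      by (simp add: scale_add_left scale_one scale_closed a_assoc)
    moreover have "cnorm A (complex_of_real r \<odot> \<one>) \<le> r"
      using r norm_one_le by (simp add: norm_scale mult_left_le)
    ultimately show "cnorm A (complex_of_real (r + 1) \<odot> \<one> \<oplus> star A y \<otimes> y) \<le> r + 1"
      using norm_triangle[of "complex_of_real r \<odot> \<one>" "\<one> \<oplus> star A y \<otimes> y"] le
      by (simp add: scale_closed)
  qed (use r in \<open>auto simp: star_mult\<close>)
  thus ?thesis
    using cstar_identity[OF y] norm_eq_zero[OF y] by simp
qed

text \<open>The mixed terms vanish, so a positive power of e + b is e plus that power of b and has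
  norm at most 2. A self-adjoint element with bounded powers has norm at most 1.\<close>

lemma norm_add_orthogonal_le:
  assumes e: "projection e" and b: "b \<in> carrier A" "star A b = b" "cnorm A b \<le> 1"
    and orth: "e \<otimes> b = \<zero>" "b \<otimes> e = \<zero>"
  shows "cnorm A (e \<oplus> b) \<le> 1"
proof (rule le_one_if_power_two_powers_le)
  fix k :: nat
  have e': "e \<in> carrier A" "star A e = e" "e \<otimes> e = e"
    using e by (auto simp: projection_def)
  have pow: "(e \<oplus> b) [^] Suc n = e \<oplus> b [^] Suc n" for n
  proof (induction n)
    case (Suc n)
    have "b [^] Suc n \<otimes> e = \<zero>"
      using b e' orth by (simp add: m_assoc)
    moreover have "(e \<oplus> b) [^] Suc (Suc n) = (e \<oplus> b [^] Suc n) \<otimes> (e \<oplus> b)"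
      using Suc by simp
    ultimately show ?case
      using b e' orth
      by (simp add: l_distr r_distr del: nat_pow_Suc)
  qed (use b e' in simp)
  \<comment> \<open>The formula for powers fails at exponent 0, where the left side is 1 and the
    right side e + 1.\<close>
  obtain n where n: "2 ^ k = Suc n"
    by (metis not0_implies_Suc power_not_zero zero_neq_numeral)
  have "(e \<oplus> b) [^] (2 ^ k :: nat) = e \<oplus> b [^] (2 ^ k :: nat)"
    unfolding n by (rule pow)
  hence "cnorm A (e \<oplus> b) ^ 2 ^ k = cnorm A (e \<oplus> b [^] (2 ^ k :: nat))"
    using norm_self_adjoint_power[of "e \<oplus> b" k] b e' by (simp add: star_add)
  also have "\<dots> \<le> 1 + 1"
    using b e' norm_power_le[of b "2 ^ k"] norm_projection_le[OF e]
    by (intro order.trans[OF norm_triangle] add_mono) auto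
  finally show "cnorm A (e \<oplus> b) ^ 2 ^ k \<le> 1 + 2 ^ k * 1"
    using one_le_power[of "2 :: real" k] by linarith
qed

text \<open>Compressing 1 - (p + q) = z* z by p shows that (z p)* (z p) = - p q p, a product of the
  form y* y that ought to be negative. In norm form, 1 - p q p is the sum of 1 - p and p (1 - q) p,
  which are mutually orthogonal and of norm at most 1. Hence z p = 0 and p q p = (q p)* (q p) =
  0.\<close>

lemma orthogonal_if_sum_le_one:
  assumes p: "projection p" and q: "projection q" and le: "cstar_le A (p \<oplus> q) \<one>"
  shows "p \<otimes> q = \<zero>"
proof -
  have p': "p \<in> carrier A" "star A p = p" "p \<otimes> p = p"
    and q': "q \<in> carrier A" "star A q = q" "q \<otimes> q = q"
    using p q by (auto simp: projection_def)
  have p_p: "p \<otimes> (p \<otimes> x) = p \<otimes> x" and q_q: "q \<otimes> (q \<otimes> x) = q \<otimes> x"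
    if "x \<in> carrier A" for x
    using that p' q' by (metis m_assoc)+
  obtain z where z: "z \<in> carrier A" "\<one> \<ominus> (p \<oplus> q) = star A z \<otimes> z"
    using le by (auto simp: cstar_le_def)
  have "star A (z \<otimes> p) \<otimes> (z \<otimes> p) = p \<otimes> (star A z \<otimes> z) \<otimes> p"
    using z p' by (simp add: star_mult star_closed m_assoc)
  also have "\<dots> = \<ominus> (p \<otimes> q \<otimes> p)"
    using p' q' by (simp add: minus_eq minus_add l_distr r_distr l_minus r_minus p_p
        m_assoc a_ac r_neg r_neg1 r_neg2 flip: z(2))
  finally have zp: "star A (z \<otimes> p) \<otimes> (z \<otimes> p) = \<ominus> (p \<otimes> q \<otimes> p)" .
  let ?b = "p \<otimes> (\<one> \<ominus> q) \<otimes> p"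
  have "\<one> \<oplus> star A (z \<otimes> p) \<otimes> (z \<otimes> p) = (\<one> \<ominus> p) \<oplus> ?b"
    using p' q' by (simp add: zp minus_eq l_distr r_distr l_minus r_minus m_assoc a_assoc r_neg1)
  moreover have "cnorm A ((\<one> \<ominus> p) \<oplus> ?b) \<le> 1"
  proof (rule norm_add_orthogonal_le)
    have "cnorm A ?b \<le> 1 * 1 * 1"
      using p' q' norm_projection_le[OF p] norm_projection_le[OF projection_complement[OF q]]
      by (intro order.trans[OF norm_mult] mult_mono mult_nonneg_nonneg norm_ge_zero) auto
    thus "cnorm A ?b \<le> 1" by simp
  qed (use p' q' projection_complement[OF p] in \<open>auto simp: star_mult star_add star_a_inv minus_eq
        l_distr r_distr l_minus r_minus m_assoc p_p r_neg l_neg\<close>)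
  ultimately have "z \<otimes> p = \<zero>"
    using z p' by (intro zero_if_norm_one_plus_star_self_le) auto
  hence "p \<otimes> q \<otimes> p = \<zero>"
    using zp p' q' z by (metis a_inv_closed l_null m_closed minus_minus minus_zero r_null star_zero
        zero_closed)
  hence "star A (q \<otimes> p) \<otimes> (q \<otimes> p) = \<zero>"
    using p' q' by (simp add: star_mult m_assoc q_q)
  hence "q \<otimes> p = \<zero>"
    using cstar_identity[of "q \<otimes> p"] norm_eq_zero[of "q \<otimes> p"] p' q' by simp
  hence "star A (q \<otimes> p) = \<zero>" by simp
  thus ?thesis using p' q' by (simp add: star_mult)
qed

subsection \<open>Corners\<close>

lemma corner_simps [simp]:
  "x \<otimes>\<^bsub>corner A p\<^esub> y = x \<otimes> y" "\<one>\<^bsub>corner A p\<^esub> = p" "\<zero>\<^bsub>corner A p\<^esub> = \<zero>"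
  "x \<oplus>\<^bsub>corner A p\<^esub> y = x \<oplus> y" "c \<odot>\<^bsub>corner A p\<^esub> x = c \<odot> x"
  "star (corner A p) x = star A x" "cnorm (corner A p) x = cnorm A x"
  by (simp_all add: corner_def)

lemma mem_corner_iff:
  assumes "projection p"
  shows "x \<in> carrier (corner A p) \<longleftrightarrow> x \<in> carrier A \<and> p \<otimes> x = x \<and> x \<otimes> p = x"
proof
  assume "x \<in> carrier (corner A p)"
  then obtain y where "y \<in> carrier A" "x = p \<otimes> y \<otimes> p"
    by (auto simp: corner_def)
  moreover have "p \<otimes> (p \<otimes> z) = p \<otimes> z" if "z \<in> carrier A" for z
    using that assms by (simp add: projection_def flip: m_assoc)
  ultimately show "x \<in> carrier A \<and> p \<otimes> x = x \<and> x \<otimes> p = x"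
    using assms by (simp add: projection_def m_assoc)
next
  assume "x \<in> carrier A \<and> p \<otimes> x = x \<and> x \<otimes> p = x"
  thus "x \<in> carrier (corner A p)"
    by (auto simp: corner_def intro!: exI[of _ x])
qed

lemma ring_corner:
  assumes "projection p"
  shows "ring (corner A p)"
proof (intro ringI abelian_groupI monoidI)
  have p: "p \<in> carrier A" "p \<otimes> p = p"
    using assms by (auto simp: projection_def)
  fix x assume "x \<in> carrier (corner A p)"
  hence x: "x \<in> carrier A" "p \<otimes> x = x" "x \<otimes> p = x"
    using assms by (auto simp: mem_corner_iff)
  show "\<exists>y\<in>carrier (corner A p). y \<oplus>\<^bsub>corner A p\<^esub> x = \<zero>\<^bsub>corner A p\<^esub>"
    using x p by (intro bexI[of _ "\<ominus> x"]) (auto simp: mem_corner_iff assms l_neg l_minus r_minus)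
qed (use assms in \<open>auto simp: mem_corner_iff projection_def m_assoc a_ac l_distr r_distr
      simp flip: m_assoc[of p]\<close>)

text \<open>Unlike the operations in \<open>corner_simps\<close>, subtraction is not a field of the
  record: the negative is selected inside the carrier, so membership in the corner matters.\<close>

lemma corner_minus [simp]:
  assumes p: "projection p" and x: "x \<in> carrier (corner A p)" "y \<in> carrier (corner A p)"
  shows "x \<ominus>\<^bsub>corner A p\<^esub> y = x \<ominus> y"
proof -
  interpret C: ring "corner A p"
    by (rule ring_corner) fact
  have "\<ominus> y \<in> carrier (corner A p)"
    using x p by (auto simp: mem_corner_iff projection_def l_minus r_minus)
  hence "\<ominus>\<^bsub>corner A p\<^esub> y = \<ominus> y"
    using x p by (intro C.minus_equality) (auto simp: mem_corner_iff l_neg)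
  thus ?thesis by (simp add: C.minus_eq minus_eq)
qed

lemma star_absorb_projection:
  assumes "projection p" "x \<in> carrier A" "p \<otimes> x = x" "x \<otimes> p = x"
  shows "p \<otimes> star A x = star A x" "star A x \<otimes> p = star A x"
  using assms by (metis projection_def star_mult)+

lemma unital_cstar_algebra_corner:
  assumes p: "projection p"
  shows "unital_cstar_algebra (corner A p)"
proof (intro unital_cstar_algebra.intro unital_cstar_algebra_axioms.intro ring_corner p)
  fix f :: "nat \<Rightarrow> 'a"
  assume f: "\<And>n. f n \<in> carrier (corner A p)" and
    cauchy: "\<And>e. e > 0 \<Longrightarrow> \<exists>n0. \<forall>m\<ge>n0. \<forall>n\<ge>n0.
      cnorm (corner A p) (f m \<ominus>\<^bsub>corner A p\<^esub> f n) < e"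
  have p': "p \<in> carrier A" "p \<otimes> p = p"
    using p by (auto simp: projection_def)
  have fA: "f n \<in> carrier A" "p \<otimes> f n = f n" "f n \<otimes> p = f n" for n
    using f[of n] p by (auto simp: mem_corner_iff)
  obtain x where x: "x \<in> carrier A" "(\<lambda>n. cnorm A (f n \<ominus> x)) \<longlonglongrightarrow> 0"
    using complete[of f] cauchy fA by (auto simp: corner_minus[OF p f f])
  \<comment> \<open>Compression by p is contractive and fixes every \<open>f n\<close>, so the
    compressed limit is a limit as well, and it lies in the corner.\<close>
  let ?y = "p \<otimes> x \<otimes> p"
  have y: "?y \<in> carrier (corner A p)"
    using x by (auto simp: corner_def)
  have "cnorm A (f n \<ominus> ?y) \<le> cnorm A (f n \<ominus> x)" for n
  proof -
    have "f n \<ominus> ?y = p \<otimes> (f n \<ominus> x) \<otimes> p"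
      using x p' fA by (simp add: minus_eq l_distr r_distr l_minus r_minus)
    moreover have "cnorm A (p \<otimes> (f n \<ominus> x) \<otimes> p) \<le> (1 * cnorm A (f n \<ominus> x)) * 1"
      using x p' fA norm_projection_le[OF p]
      by (intro order.trans[OF norm_mult] mult_mono mult_nonneg_nonneg norm_ge_zero) auto
    ultimately show ?thesis by simp
  qed
  moreover have "0 \<le> cnorm A (f n \<ominus> ?y)" for n
    using x p' fA by (intro norm_ge_zero) auto
  ultimately have "(\<lambda>n. cnorm A (f n \<ominus> ?y)) \<longlonglongrightarrow> 0"
    by (intro tendsto_sandwich[OF _ _ tendsto_const x(2)]) auto
  thus "\<exists>x\<in>carrier (corner A p).
      (\<lambda>n. cnorm (corner A p) (f n \<ominus>\<^bsub>corner A p\<^esub> x)) \<longlonglongrightarrow> 0"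
    using y by (intro bexI[OF _ y]) (simp add: corner_minus[OF p f y])
qed (use p in \<open>auto simp: mem_corner_iff projection_def scale_closed scale_add_left scale_add_right
      scale_scale scale_one scale_mult_left scale_mult_right star_closed star_star star_add star_scale
      norm_ge_zero norm_eq_zero norm_triangle norm_scale norm_mult cstar_identity
      star_mult intro: star_absorb_projection[OF p]\<close>)

end

section \<open>Homomorphisms fixing the generators, and restriction of actions to corners\<close>

lemma star_hom_diff:
  assumes "unital_cstar_algebra A" "unital_cstar_algebra B" "star_hom A B h"
    and "x \<in> carrier A" "y \<in> carrier A"
  shows "h (x \<ominus>\<^bsub>A\<^esub> y) = h x \<ominus>\<^bsub>B\<^esub> h y"
proof -
  interpret A: unital_cstar_algebra A by fact
  interpret B: unital_cstar_algebra B by fact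
  have "h \<in> ring_hom A B" "h ((-1) \<odot>\<^bsub>A\<^esub> y) = (-1) \<odot>\<^bsub>B\<^esub> h y"
    using assms by (auto simp: star_hom_def)
  thus ?thesis
    using assms by (simp add: A.minus_eq B.minus_eq A.a_inv_eq_scale B.a_inv_eq_scale A.scale_closed
        ring_hom_add ring_hom_closed)
qed

text \<open>The fixed points form a *-subalgebra containing the generators, hence a dense one, and
  contractivity carries the identity h x = x to limits. It is used to see that time 1 of each action
  is trivial.\<close>

lemma star_hom_fixes_if_generates:
  assumes A: "unital_cstar_algebra A" and h: "star_hom A A h" and gen: "generates A S"
    and S: "\<And>j. S j \<in> carrier A" "\<And>j. h (S j) = S j" and x: "x \<in> carrier A"
  shows "h x = x"
proof -
  interpret unital_cstar_algebra A by fact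
  have hom: "h \<in> ring_hom A A"
    using h by (simp add: star_hom_def)
  note hom_closed = ring_hom_closed[OF hom]
  define D where "D = {y \<in> carrier A. h y = y}"
  have "star_subalgebra A D" "\<one>\<^bsub>A\<^esub> \<in> D" "range S \<subseteq> D"
    using h S ring_hom_zero[OF hom ring_axioms ring_axioms]
    by (auto simp: D_def star_subalgebra_def star_hom_def scale_closed star_closed
        ring_hom_add ring_hom_mult ring_hom_one)
  hence dense: "norm_dense A D"
    using gen by (auto simp: generates_def)
  have "cnorm A (h x \<ominus>\<^bsub>A\<^esub> x) \<le> 0 + 2 * e" if "e > 0" for e
  proof -
    obtain y where y: "y \<in> D" "cnorm A (x \<ominus>\<^bsub>A\<^esub> y) < e"
      using dense x \<open>e > 0\<close> by (auto simp: norm_dense_def)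
    hence y': "y \<in> carrier A" "h y = y"
      by (auto simp: D_def)
    have "cnorm A (h x \<ominus>\<^bsub>A\<^esub> y) = cnorm A (h (x \<ominus>\<^bsub>A\<^esub> y))"
      using x y' by (simp add: star_hom_diff[OF A A h])
    also have "\<dots> \<le> cnorm A (x \<ominus>\<^bsub>A\<^esub> y)"
      using x y' by (intro star_hom_norm_le[OF A A h]) auto
    finally show ?thesis
      using y norm_diff_triangle[of "h x" y x] norm_diff_commute[of x y] x y' hom_closed[OF x]
      by linarith
  qed
  hence "cnorm A (h x \<ominus>\<^bsub>A\<^esub> x) \<le> 0 + e" if "e > 0" for e
    using that by (metis divide_pos_pos nonzero_mult_div_cancel_left times_divide_eq_right
        zero_less_numeral zero_neq_numeral)
  hence "cnorm A (h x \<ominus>\<^bsub>A\<^esub> x) \<le> 0"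
    by (rule field_le_epsilon)
  thus ?thesis
    using x hom_closed[OF x] norm_ge_zero[of "h x \<ominus>\<^bsub>A\<^esub> x"]
    by (intro eq_if_norm_diff_zero) auto
qed

lemma one_parameter_action_corner:
  assumes A: "unital_cstar_algebra A" and act: "one_parameter_action A \<sigma>"
    and p: "unital_cstar_algebra.projection A p" and fixed: "\<And>t. \<sigma> t p = p"
  shows "one_parameter_action (corner A p) \<sigma>"
proof -
  interpret unital_cstar_algebra A by fact
  let ?C = "corner A p"
  have p': "p \<in> carrier A"
    using p by (simp add: projection_def)
  have hom: "\<sigma> t \<in> ring_hom A A"
    and star_hom: "\<And>x. x \<in> carrier A \<Longrightarrow> \<sigma> t (star A x) = star A (\<sigma> t x)"
      "\<And>x c. x \<in> carrier A \<Longrightarrow> \<sigma> t (c \<odot>\<^bsub>A\<^esub> x) = c \<odot>\<^bsub>A\<^esub> \<sigma> t x"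
    and bij: "bij_betw (\<sigma> t) (carrier A) (carrier A)" for t
    using act by (auto simp: one_parameter_action_def star_automorphism_def star_hom_def)
  have zero: "\<sigma> 0 x = x" and add: "\<sigma> (s + t) x = \<sigma> s (\<sigma> t x)" if "x \<in> carrier A" for x s t
    using act that by (auto simp: one_parameter_action_def)
  have closed: "\<sigma> t x \<in> carrier ?C" if "x \<in> carrier ?C" for x t
    using that p p' by (simp add: mem_corner_iff ring_hom_closed[OF hom] fixed
        flip: ring_hom_mult[OF hom, of p, unfolded fixed] ring_hom_mult[OF hom, of _ p, unfolded fixed])
  have C_A: "x \<in> carrier A" if "x \<in> carrier ?C" for x
    using that p by (simp add: mem_corner_iff)
  have "star_hom ?C ?C (\<sigma> t)" for t
    using closed fixed p by (auto simp: star_hom_def star_hom ring_hom_def C_A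
        ring_hom_mult[OF hom] ring_hom_add[OF hom])
  moreover have "bij_betw (\<sigma> t) (carrier ?C) (carrier ?C)" for t
  proof (intro bij_betw_imageI)
    show "inj_on (\<sigma> t) (carrier ?C)"
      using bij[of t] C_A by (auto simp: bij_betw_def inj_on_def)
    \<comment> \<open>Surjectivity does not descend by itself; the preimage under time t is the
      image under time -t, which stays in the corner because p is fixed at all times.\<close>
    have "y \<in> \<sigma> t ` carrier ?C" if "y \<in> carrier ?C" for y
      using that closed[OF that, of "- t"] add[of y t "- t"] zero C_A
      by (intro image_eqI[of _ _ "\<sigma> (- t) y"]) auto
    thus "\<sigma> t ` carrier ?C = carrier ?C"
      using closed by auto
  qed
  moreover have "((\<lambda>t. cnorm ?C (\<sigma> t x \<ominus>\<^bsub>?C\<^esub> \<sigma> s x)) \<longlongrightarrow> 0) (at s)"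
    if "x \<in> carrier ?C" for x s
    using act C_A[OF that] by (simp add: corner_minus[OF p closed closed] that one_parameter_action_def)
  ultimately show ?thesis
    using zero add C_A by (auto simp: one_parameter_action_def star_automorphism_def)
qed

section \<open>States and KMS states\<close>

lemma
  assumes "state A \<phi>" "x \<in> carrier A"
  shows state_add: "y \<in> carrier A \<Longrightarrow> \<phi> (x \<oplus>\<^bsub>A\<^esub> y) = \<phi> x + \<phi> y"
    and state_scale: "\<phi> (c \<odot>\<^bsub>A\<^esub> x) = c * \<phi> x"
    and state_nonneg: "\<phi> (star A x \<otimes>\<^bsub>A\<^esub> x) \<in> \<real>\<^sub>\<ge>\<^sub>0"
  using assms by (auto simp: state_def)

lemma state_diff:
  assumes "unital_cstar_algebra A" "state A \<phi>" "x \<in> carrier A" "y \<in> carrier A"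
  shows "\<phi> (x \<ominus>\<^bsub>A\<^esub> y) = \<phi> x - \<phi> y"
proof -
  interpret unital_cstar_algebra A by fact
  show ?thesis
    using assms by (simp add: minus_eq a_inv_eq_scale state_add state_scale scale_closed)
qed

lemma state_zero:
  assumes "unital_cstar_algebra A" "state A \<phi>"
  shows "\<phi> \<zero>\<^bsub>A\<^esub> = 0"
proof -
  interpret unital_cstar_algebra A by fact
  show ?thesis
    using state_scale[OF assms(2), of "\<zero>\<^bsub>A\<^esub>" 0] by simp
qed

lemma state_norm_le:
  assumes "unital_cstar_algebra A" "state A \<phi>" "x \<in> carrier A"
  shows "cmod (\<phi> x) \<le> cnorm A x"
proof -
  interpret unital_cstar_algebra A by fact
  show ?thesis
  proof (cases "cnorm A x = 0")
    case True
    thus ?thesis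
      using assms state_zero[OF assms(1,2)] by (simp add: norm_eq_zero)
  next
    case False
    hence pos: "cnorm A x > 0"
      using norm_ge_zero[OF assms(3)] by simp
    let ?y = "complex_of_real (1 / cnorm A x) \<odot>\<^bsub>A\<^esub> x"
    have "?y \<in> {x \<in> carrier A. cnorm A x \<le> 1}"
      using pos assms by (simp add: scale_closed norm_scale norm_divide)
    hence "cmod (\<phi> ?y) \<le> (SUP x \<in> {x \<in> carrier A. cnorm A x \<le> 1}. cmod (\<phi> x))"
      using assms(2) by (intro cSUP_upper) (auto simp: state_def)
    hence "cmod (\<phi> ?y) \<le> 1"
      using assms(2) by (simp add: state_def)
    thus ?thesis
      using pos assms by (simp add: state_scale norm_mult norm_divide)
  qed
qed

text \<open>If the unit is sent to 0, then \<phi> (y* y) for y = x + t c 1 has no quadratic term in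
  t. An affine function that is nonnegative on the whole real line has slope 0, and varying c yields
  \<phi> x = 0 for all x, against norm one.\<close>

lemma state_one_nonzero:
  assumes "unital_cstar_algebra A" "state A \<phi>"
  shows "\<phi> \<one>\<^bsub>A\<^esub> \<noteq> 0"
proof
  interpret unital_cstar_algebra A by fact
  note \<phi> = state_add[OF assms(2)] state_scale[OF assms(2)]
  assume zero: "\<phi> \<one>\<^bsub>A\<^esub> = 0"
  have vanish: "\<phi> x = 0" if x: "x \<in> carrier A" for x
  proof -
    have *: "c * \<phi> (star A x) + cnj c * \<phi> x = 0" for c
    proof -
      define w where "w = c * \<phi> (star A x) + cnj c * \<phi> x"
      define m where "m = \<phi> (star A x \<otimes>\<^bsub>A\<^esub> x)"
      have m: "m \<in> \<real>\<^sub>\<ge>\<^sub>0"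
        unfolding m_def by (rule state_nonneg[OF assms(2) x])
      have nonneg: "m + complex_of_real t * w \<in> \<real>\<^sub>\<ge>\<^sub>0" for t
      proof -
        let ?c = "complex_of_real t * c"
        let ?y = "x \<oplus>\<^bsub>A\<^esub> ?c \<odot>\<^bsub>A\<^esub> \<one>\<^bsub>A\<^esub>"
        have "\<phi> (star A ?y \<otimes>\<^bsub>A\<^esub> ?y) = m + complex_of_real t * w"
          using x by (simp add: star_add star_scale star_closed scale_closed l_distr r_distr
              scale_mult_left scale_mult_right \<phi> zero m_def w_def algebra_simps)
        thus ?thesis
          using state_nonneg[OF assms(2), of ?y] x by (simp add: scale_closed)
      qed
      have im: "Im w = 0"
        using nonneg[of 1] m by (auto simp: complex_nonneg_Reals_iff)
      have "Re w = 0"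
      proof (rule ccontr)
        assume "Re w \<noteq> 0"
        thus False
          \<comment> \<open>At this value of t the real part equals -1.\<close>
          using nonneg[of "- (Re m + 1) / Re w"] by (simp add: complex_nonneg_Reals_iff)
      qed
      with im show ?thesis
        by (simp add: w_def complex_eq_iff)
    qed
    \<comment> \<open>The choice c = 1 makes the values at x and x* opposite, and c = i makes them
      equal.\<close>
    have "\<phi> (star A x) = - \<phi> x"
      using *[of 1] by (simp add: eq_neg_iff_add_eq_0)
    with *[of \<i>] show ?thesis by simp
  qed
  have "(SUP x \<in> {x \<in> carrier A. cnorm A x \<le> 1}. cmod (\<phi> x)) =
      (SUP x \<in> {x \<in> carrier A. cnorm A x \<le> 1}. (0 :: real))"
    by (intro SUP_cong) (auto simp: vanish)
  also have "\<dots> = 0"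
    by (intro cSUP_const) (auto intro: exI[of _ "\<zero>\<^bsub>A\<^esub>"])
  finally show False
    using assms(2) by (simp add: state_def)
qed

section \<open>Analytic continuation and averaging of the KMS condition\<close>

text \<open>The difference quotients of F converge in norm, and left multiplication by x followed by
  \<phi> is linear and bounded, so it maps the derivative of F to a complex derivative.\<close>

lemma holomorphic_state_entire:
  assumes "unital_cstar_algebra A" "state A \<phi>" "x \<in> carrier A" "entire_function A F"
  shows "(\<lambda>z. \<phi> (x \<otimes>\<^bsub>A\<^esub> F z)) holomorphic_on UNIV"
proof -
  interpret unital_cstar_algebra A by fact
  have "\<exists>d. ((\<lambda>z. \<phi> (x \<otimes>\<^bsub>A\<^esub> F z)) has_field_derivative d) (at z)" for z
  proof -
    have F: "F z \<in> carrier A" for z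
      using assms(4) by (simp add: entire_function_def)
    let ?q = "\<lambda>h. inverse h \<odot>\<^bsub>A\<^esub> (F (z + h) \<ominus>\<^bsub>A\<^esub> F z)"
    obtain d where d: "d \<in> carrier A" "((\<lambda>h. cnorm A (?q h \<ominus>\<^bsub>A\<^esub> d)) \<longlongrightarrow> 0) (at 0)"
      using assms(4) by (auto simp: entire_function_def)
    have eq: "(\<phi> (x \<otimes>\<^bsub>A\<^esub> F (z + h)) - \<phi> (x \<otimes>\<^bsub>A\<^esub> F z)) / h = \<phi> (x \<otimes>\<^bsub>A\<^esub> ?q h)" for h
    proof -
      have "\<phi> (x \<otimes>\<^bsub>A\<^esub> F (z + h)) - \<phi> (x \<otimes>\<^bsub>A\<^esub> F z) = \<phi> (x \<otimes>\<^bsub>A\<^esub> (F (z + h) \<ominus>\<^bsub>A\<^esub> F z))"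
        using assms F by (simp add: state_diff[OF assms(1,2), symmetric] minus_eq r_distr r_minus)
      thus ?thesis
        using assms F by (simp add: scale_mult_right state_scale[OF assms(2)] divide_inverse)
    qed
    have le: "cmod (\<phi> (x \<otimes>\<^bsub>A\<^esub> ?q h) - \<phi> (x \<otimes>\<^bsub>A\<^esub> d)) \<le> cnorm A x * cnorm A (?q h \<ominus>\<^bsub>A\<^esub> d)" for h
    proof -
      have "\<phi> (x \<otimes>\<^bsub>A\<^esub> ?q h) - \<phi> (x \<otimes>\<^bsub>A\<^esub> d) = \<phi> (x \<otimes>\<^bsub>A\<^esub> (?q h \<ominus>\<^bsub>A\<^esub> d))"
        using assms F d
        by (simp add: state_diff[OF assms(1,2), symmetric] scale_closed minus_eq r_distr r_minus)
      also have "cmod \<dots> \<le> cnorm A (x \<otimes>\<^bsub>A\<^esub> (?q h \<ominus>\<^bsub>A\<^esub> d))"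
        using assms F d by (intro state_norm_le) (auto simp: scale_closed)
      also have "\<dots> \<le> cnorm A x * cnorm A (?q h \<ominus>\<^bsub>A\<^esub> d)"
        using assms F d by (intro norm_mult) (auto simp: scale_closed)
      finally show ?thesis .
    qed
    have "((\<lambda>h. cnorm A x * cnorm A (?q h \<ominus>\<^bsub>A\<^esub> d)) \<longlongrightarrow> 0) (at 0)"
      by (rule tendsto_mult_right_zero) (rule d)
    hence "((\<lambda>h. \<phi> (x \<otimes>\<^bsub>A\<^esub> ?q h) - \<phi> (x \<otimes>\<^bsub>A\<^esub> d)) \<longlongrightarrow> 0) (at 0)"
      by (rule Lim_null_comparison[OF always_eventually[OF allI[OF le]]])
    hence "((\<lambda>z. \<phi> (x \<otimes>\<^bsub>A\<^esub> F z)) has_field_derivative \<phi> (x \<otimes>\<^bsub>A\<^esub> d)) (at z)"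
      unfolding DERIV_def eq by (rule Lim_null[THEN iffD2])
    thus ?thesis by blast
  qed
  thus ?thesis
    by (auto simp: holomorphic_on_def field_differentiable_def)
qed

text \<open>
  For a primitive \<open>H\<close> of \<open>g\<close>, the function \<open>H (z + 1) - H z\<close> is constant; it is the mean of
  \<open>g\<close> over any horizontal segment of length one.
\<close>

lemma periodic_entire_approx_eq:
  fixes g :: "complex \<Rightarrow> complex"
  assumes g: "g holomorphic_on UNIV" and per: "\<And>z. g (z + 1) = g z"
    and u: "\<And>t :: real. cmod (g (u + complex_of_real t) - c) \<le> B"
    and v: "\<And>t :: real. cmod (g (v + complex_of_real t) - d) \<le> C"
  shows "cmod (c - d) \<le> B + C"
proof -
  obtain H where H: "\<And>z. (H has_field_derivative g z) (at z)"
    using holomorphic_convex_primitive'[OF convex_UNIV open_UNIV g] by auto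
  have "((\<lambda>z. H (z + 1) - H z) has_field_derivative 0) (at z)" for z
  proof -
    have "((\<lambda>z. H (z + 1)) has_field_derivative g (z + 1)) (at z)"
      using H[of "z + 1"] by (rule DERIV_shift[THEN iffD1])
    from DERIV_diff[OF this H[of z]] show ?thesis
      by (simp add: per)
  qed
  hence "\<exists>K. \<forall>z \<in> UNIV. H (z + 1) - H z = K"
    by (intro has_field_derivative_zero_constant) auto
  then obtain K where K: "\<And>z. H (z + 1) - H z = K"
    by blast
  \<comment> \<open>K - e is the increment of H z - e z from w to w + 1, and the derivative of that
    function is bounded by M on the segment. The same K serves both lines.\<close>
  have mean: "cmod (K - e) \<le> M" if le: "\<And>t :: real. cmod (g (w + complex_of_real t) - e) \<le> M" for w e M
  proof -
    let ?f = "\<lambda>z. H z - e * z"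
    have "cmod (?f (w + 1) - ?f w) \<le> M * cmod (w + 1 - w)"
    proof (rule field_differentiable_bound[OF convex_closed_segment])
      fix z assume "z \<in> closed_segment w (w + 1)"
      then obtain t where "z = w + complex_of_real t"
        by (auto simp: closed_segment_def scaleR_conv_of_real algebra_simps)
      thus "cmod (g z - e) \<le> M"
        using le by simp
      show "(?f has_field_derivative g z - e) (at z within closed_segment w (w + 1))"
        by (rule has_field_derivative_at_within) (auto intro!: derivative_eq_intros H)
    qed auto
    thus ?thesis
      using K[of w] by (simp add: algebra_simps)
  qed
  have "cmod (c - d) \<le> cmod (K - c) + cmod (K - d)"
    using norm_triangle_ineq4[of "K - d" "K - c"] by simp
  also have "\<dots> \<le> B + C"
    using mean[of u c B, OF u] mean[of v d C, OF v] by simp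
  finally show ?thesis .
qed

text \<open>
  The elements of the dense subalgebra need not be homogeneous, so \<open>v\<close> is only approximated by
  some \<open>y\<close> in it; averaging \<open>z \<mapsto> e\<^bsup>-2\<pi>ikz\<^esup> \<phi> (x \<sigma>\<^sub>z(y))\<close> over the horizontal lines
  through \<open>0\<close> and \<open>ib\<close> compares the two sides.
\<close>

lemma kms_homogeneous:
  fixes A :: "'a cstar_alg" and \<phi> :: "'a \<Rightarrow> complex"
  assumes A: "unital_cstar_algebra A" and act: "one_parameter_action A \<sigma>"
    and kms: "kms_state_at A \<sigma> b \<phi>"
    and period: "\<And>x. x \<in> carrier A \<Longrightarrow> \<sigma> 1 x = x"
    and v: "v \<in> carrier A" "\<And>t. \<sigma> t v = cis (2 * pi * of_int k * t) \<odot>\<^bsub>A\<^esub> v"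
  shows "\<phi> (star A v \<otimes>\<^bsub>A\<^esub> v) = exp (2 * pi * of_int k * b) * \<phi> (v \<otimes>\<^bsub>A\<^esub> star A v)"
proof -
  interpret unital_cstar_algebra A by fact
  have hom: "star_hom A A (\<sigma> t)" for t
    using act by (simp add: one_parameter_action_def star_automorphism_def)
  have \<sigma>_closed [simp]: "\<sigma> t x \<in> carrier A" if "x \<in> carrier A" for t x
    using hom[of t] that by (auto simp: star_hom_def intro: ring_hom_closed)
  have \<sigma>_le: "cnorm A (\<sigma> t x) \<le> cnorm A x" if "x \<in> carrier A" for t x
    by (rule star_hom_norm_le[OF A A hom that])
  have \<sigma>_add: "\<sigma> (s + t) x = \<sigma> s (\<sigma> t x)" if "x \<in> carrier A" for s t x
    using act that by (simp add: one_parameter_action_def)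
  have st: "state A \<phi>"
    using kms by (simp add: kms_state_at_def)
  from kms obtain D where D: "star_subalgebra A D" "norm_dense A D" "\<forall>t. \<sigma> t ` D \<subseteq> D"
      "D \<subseteq> entire_elements A \<sigma>"
    and kms_D: "\<forall>x \<in> D. \<forall>y \<in> D. \<forall>F. entire_extension A \<sigma> y F \<longrightarrow>
      \<phi> (x \<otimes>\<^bsub>A\<^esub> F (\<i> * complex_of_real b)) = \<phi> (y \<otimes>\<^bsub>A\<^esub> x)"
    unfolding kms_state_at_def by (elim conjE exE) (rule that)
  define E where "E = exp (2 * pi * of_int k * b)"
  have E: "E > 0"
    by (simp add: E_def)
  have approx: "cmod (\<phi> (star A v \<otimes>\<^bsub>A\<^esub> v) - E * \<phi> (v \<otimes>\<^bsub>A\<^esub> star A v)) \<le>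
      (1 + E) * ((cnorm A v + e) * e + e * cnorm A v)" if e: "e > 0" for e
  proof -
    have dense: "\<exists>y \<in> D. cnorm A (z \<ominus>\<^bsub>A\<^esub> y) < e" if "z \<in> carrier A" for z
      using D(2) e that by (simp add: norm_dense_def)
    obtain x where x: "x \<in> D" "cnorm A (star A v \<ominus>\<^bsub>A\<^esub> x) < e"
      using dense[OF star_closed[OF v(1)]] by blast
    obtain y where y: "y \<in> D" "cnorm A (v \<ominus>\<^bsub>A\<^esub> y) < e"
      using dense[OF v(1)] by blast
    have [simp]: "x \<in> carrier A" "y \<in> carrier A" "v \<in> carrier A" "star A v \<in> carrier A"
      using x y D(1) v by (auto simp: star_subalgebra_def star_closed)
    obtain F where F: "entire_extension A \<sigma> y F"
      using D(4) y by (auto simp: entire_elements_def)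
    have F_closed [simp]: "F z \<in> carrier A" for z
      using F by (simp add: entire_extension_def entire_function_def)
    have F_real: "F (complex_of_real t) = \<sigma> t y" for t
      using F by (simp add: entire_extension_def)
    define f where "f = (\<lambda>z. \<phi> (x \<otimes>\<^bsub>A\<^esub> F z))"
    have f: "f holomorphic_on UNIV"
      unfolding f_def using F by (intro holomorphic_state_entire A st) (auto simp: entire_extension_def)
    \<comment> \<open>The KMS condition speaks of the single point ib. Applied to \<sigma> t y,
      whose entire extension is a translate of F, it covers the whole horizontal line through
      ib.\<close>
    have f_kms: "f (\<i> * complex_of_real b + complex_of_real t) = \<phi> (\<sigma> t y \<otimes>\<^bsub>A\<^esub> x)" for t
    proof -
      have "entire_function A (\<lambda>z. F (z + complex_of_real t))"
        unfolding entire_function_def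
      proof (intro conjI allI F_closed)
        fix z
        have "\<exists>d \<in> carrier A. ((\<lambda>h. cnorm A ((inverse h \<odot>\<^bsub>A\<^esub>
            (F ((z + complex_of_real t) + h) \<ominus>\<^bsub>A\<^esub> F (z + complex_of_real t))) \<ominus>\<^bsub>A\<^esub> d)) \<longlongrightarrow> 0) (at 0)"
          using F unfolding entire_extension_def entire_function_def by blast
        thus "\<exists>d \<in> carrier A. ((\<lambda>h. cnorm A ((inverse h \<odot>\<^bsub>A\<^esub>
            (F (z + h + complex_of_real t) \<ominus>\<^bsub>A\<^esub> F (z + complex_of_real t))) \<ominus>\<^bsub>A\<^esub> d)) \<longlongrightarrow> 0) (at 0)"
          by (simp add: add_ac)
      qed
      hence ext: "entire_extension A \<sigma> (\<sigma> t y) (\<lambda>z. F (z + complex_of_real t))"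
        using F_real[of "s + t" for s] by (auto simp: entire_extension_def \<sigma>_add)
      have "\<sigma> t y \<in> D"
        using D(3) y by auto
      from kms_D[rule_format, OF x(1) this ext] show ?thesis
        by (simp add: f_def)
    qed
    \<comment> \<open>On the real axis this is triviality of the action at time 1; the identity
      theorem spreads it to the plane.\<close>
    have f_periodic: "f (z + 1) = f z" for z
    proof -
      have "f (z + 1) - f z = 0"
      proof (rule analytic_continuation[of "\<lambda>z. f (z + 1) - f z" UNIV \<real> 0 z])
        show "(\<lambda>z. f (z + 1) - f z) holomorphic_on UNIV"
        proof (rule holomorphic_on_diff[OF _ f])
          show "(\<lambda>z. f (z + 1)) holomorphic_on UNIV"
            by (rule holomorphic_on_compose_gen[OF _ f, of "\<lambda>z. z + 1" UNIV, unfolded o_def])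
              (auto intro: holomorphic_intros)
        qed
        show "(0 :: complex) islimpt \<real>"
          unfolding islimpt_approachable
        proof (intro allI impI)
          fix e :: real assume "e > 0"
          thus "\<exists>x\<in>\<real>. x \<noteq> 0 \<and> dist x (0 :: complex) < e"
            by (intro bexI[of _ "complex_of_real (e / 2)"]) auto
        qed
        fix z :: complex assume "z \<in> \<real>"
        then obtain t where t: "z = complex_of_real t"
          by (auto elim: Reals_cases)
        have "F (z + 1) = F z"
          using F_real[of "t + 1"] F_real[of t] by (simp add: t \<sigma>_add period)
        thus "f (z + 1) - f z = 0"
          by (simp add: f_def)
      qed auto
      thus ?thesis by simp
    qed
    \<comment> \<open>On real t the exponential undoes the phase of \<sigma> t v, and at ib it
      equals \<open>E\<close>. It has period 1 because k is an integer.\<close>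
    define g where "g = (\<lambda>z. exp (- (2 * pi * \<i> * of_int k * z)) * f z)"
    have g_eq: "g (w + complex_of_real t) =
        exp (- (2 * pi * \<i> * of_int k * w)) * (cis (- (2 * pi * of_int k * t)) * f (w + complex_of_real t))"
      for w t
      by (simp add: g_def cis_conv_exp ring_distribs exp_add exp_diff exp_minus mult_ac field_simps)
    have \<sigma>_y: "cnorm A (\<sigma> t y \<ominus>\<^bsub>A\<^esub> \<sigma> t v) \<le> e" "cnorm A (\<sigma> t y) \<le> cnorm A v + e"
        "cnorm A (\<sigma> t v) \<le> cnorm A v" for t
    proof -
      show "cnorm A (\<sigma> t y \<ominus>\<^bsub>A\<^esub> \<sigma> t v) \<le> e"
        using \<sigma>_le[of "y \<ominus>\<^bsub>A\<^esub> v" t] y norm_diff_commute[of v y]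
        by (simp add: star_hom_diff[OF A A hom])
      have "y = v \<ominus>\<^bsub>A\<^esub> (v \<ominus>\<^bsub>A\<^esub> y)"
        by (simp add: diff_diff_self)
      hence "cnorm A y \<le> cnorm A v + e"
        using norm_diff_le[of v "v \<ominus>\<^bsub>A\<^esub> y"] y by simp
      thus "cnorm A (\<sigma> t y) \<le> cnorm A v + e"
        using \<sigma>_le[of y t] by simp
    qed (rule \<sigma>_le[OF v(1)])
    have x_le: "cnorm A (x \<ominus>\<^bsub>A\<^esub> star A v) \<le> e" "cnorm A x \<le> cnorm A v + e"
    proof -
      show "cnorm A (x \<ominus>\<^bsub>A\<^esub> star A v) \<le> e"
        using x norm_diff_commute[of x "star A v"] by simp
      have "x = star A v \<ominus>\<^bsub>A\<^esub> (star A v \<ominus>\<^bsub>A\<^esub> x)"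
        by (simp add: diff_diff_self)
      thus "cnorm A x \<le> cnorm A v + e"
        using norm_diff_le[of "star A v" "star A v \<ominus>\<^bsub>A\<^esub> x"] x by simp
    qed
    \<comment> \<open>The error of a product of two factors, each replaced at cost e; contractivity
      of the action makes it independent of t.\<close>
    let ?B = "(cnorm A v + e) * e + e * cnorm A v"
    have v_nonneg: "0 \<le> cnorm A v"
      by (simp add: norm_ge_zero)
    have real_line: "cmod (g (0 + complex_of_real t) - \<phi> (star A v \<otimes>\<^bsub>A\<^esub> v)) \<le> ?B" for t
    proof -
      have "\<phi> (star A v \<otimes>\<^bsub>A\<^esub> v) = cis (- (2 * pi * of_int k * t)) * \<phi> (star A v \<otimes>\<^bsub>A\<^esub> \<sigma> t v)"
        by (simp add: v(2) scale_mult_right state_scale[OF st] cis_mult flip: mult.assoc)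
      hence "cmod (g (0 + complex_of_real t) - \<phi> (star A v \<otimes>\<^bsub>A\<^esub> v)) =
          cmod (\<phi> (x \<otimes>\<^bsub>A\<^esub> \<sigma> t y) - \<phi> (star A v \<otimes>\<^bsub>A\<^esub> \<sigma> t v))"
        by (simp only: g_eq) (simp add: f_def F_real Real_Vector_Spaces.norm_mult flip: right_diff_distrib)
      also have "\<dots> \<le> cnorm A (x \<otimes>\<^bsub>A\<^esub> \<sigma> t y \<ominus>\<^bsub>A\<^esub> star A v \<otimes>\<^bsub>A\<^esub> \<sigma> t v)"
        using state_norm_le[OF A st] by (simp add: state_diff[OF A st, symmetric])
      also have "\<dots> \<le> cnorm A x * cnorm A (\<sigma> t y \<ominus>\<^bsub>A\<^esub> \<sigma> t v) +
          cnorm A (x \<ominus>\<^bsub>A\<^esub> star A v) * cnorm A (\<sigma> t v)"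
        by (intro norm_diff_mult_le) auto
      also have "\<dots> \<le> ?B"
        using x_le \<sigma>_y e v_nonneg by (intro add_mono mult_mono norm_ge_zero) auto
      finally show ?thesis .
    qed
    have shifted_line: "cmod (g (\<i> * complex_of_real b + complex_of_real t) -
        E * \<phi> (v \<otimes>\<^bsub>A\<^esub> star A v)) \<le> E * ?B" for t
    proof -
      have "- (2 * pi * \<i> * of_int k * (\<i> * complex_of_real b)) = complex_of_real (2 * pi * of_int k * b)"
        by (simp add: complex_eq_iff)
      hence "exp (- (2 * pi * \<i> * of_int k * (\<i> * complex_of_real b))) = complex_of_real E"
        by (simp only: E_def exp_of_real)
      moreover have "\<phi> (v \<otimes>\<^bsub>A\<^esub> star A v) =
          cis (- (2 * pi * of_int k * t)) * \<phi> (\<sigma> t v \<otimes>\<^bsub>A\<^esub> star A v)"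
        by (simp add: v(2) scale_mult_left state_scale[OF st] cis_mult flip: mult.assoc)
      ultimately have "cmod (g (\<i> * complex_of_real b + complex_of_real t) -
          E * \<phi> (v \<otimes>\<^bsub>A\<^esub> star A v)) =
          E * cmod (\<phi> (\<sigma> t y \<otimes>\<^bsub>A\<^esub> x) - \<phi> (\<sigma> t v \<otimes>\<^bsub>A\<^esub> star A v))"
        using E by (simp only: g_eq f_kms) (simp add: Real_Vector_Spaces.norm_mult flip: right_diff_distrib)
      also have "cmod (\<phi> (\<sigma> t y \<otimes>\<^bsub>A\<^esub> x) - \<phi> (\<sigma> t v \<otimes>\<^bsub>A\<^esub> star A v)) \<le>
          cnorm A (\<sigma> t y \<otimes>\<^bsub>A\<^esub> x \<ominus>\<^bsub>A\<^esub> \<sigma> t v \<otimes>\<^bsub>A\<^esub> star A v)"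
        using state_norm_le[OF A st] by (simp add: state_diff[OF A st, symmetric])
      also have "\<dots> \<le> cnorm A (\<sigma> t y) * cnorm A (x \<ominus>\<^bsub>A\<^esub> star A v) +
          cnorm A (\<sigma> t y \<ominus>\<^bsub>A\<^esub> \<sigma> t v) * cnorm A (star A v)"
        by (intro norm_diff_mult_le) auto
      also have "\<dots> \<le> ?B"
        using x_le \<sigma>_y e v_nonneg by (intro add_mono mult_mono norm_ge_zero) auto
      finally show ?thesis using E by simp
    qed
    have "cmod (\<phi> (star A v \<otimes>\<^bsub>A\<^esub> v) - E * \<phi> (v \<otimes>\<^bsub>A\<^esub> star A v)) \<le> ?B + E * ?B"
    proof (rule periodic_entire_approx_eq[OF _ _ real_line shifted_line])
      show "g holomorphic_on UNIV"
        unfolding g_def by (intro holomorphic_intros f)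
      have "exp (- (2 * pi * \<i> * of_int k)) = (1 :: complex)"
        using exp_integer_2pi[of "of_int (- k)"] by (simp add: mult_ac)
      moreover have "exp (- (w * (z + 1))) = exp (- (w * z)) * exp (- w)" for w z :: complex
        by (simp add: ring_distribs flip: exp_add)
      ultimately show "g (z + 1) = g z" for z
        by (simp add: g_def f_periodic)
    qed
    thus ?thesis
      by (simp add: algebra_simps)
  qed
  have "((\<lambda>e. (1 + E) * ((cnorm A v + e) * e + e * cnorm A v)) \<longlongrightarrow>
      (1 + E) * ((cnorm A v + 0) * 0 + 0 * cnorm A v)) (at_right 0)"
    by (intro tendsto_intros)
  moreover have "eventually (\<lambda>e. cmod (\<phi> (star A v \<otimes>\<^bsub>A\<^esub> v) - E * \<phi> (v \<otimes>\<^bsub>A\<^esub> star A v)) \<le>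
      (1 + E) * ((cnorm A v + e) * e + e * cnorm A v)) (at_right 0)"
    by (rule eventually_mono[OF eventually_at_right_less approx])
  ultimately have "cmod (\<phi> (star A v \<otimes>\<^bsub>A\<^esub> v) - E * \<phi> (v \<otimes>\<^bsub>A\<^esub> star A v)) \<le>
      (1 + E) * ((cnorm A v + 0) * 0 + 0 * cnorm A v)"
    by (rule tendsto_lowerbound) simp
  thus ?thesis
    by (simp add: E_def)
qed

text \<open>Formulated for an arbitrary family V so that it applies to the full algebra and to the
  corner alike, with the unit of the respective algebra.\<close>

lemma no_kms_state_if_homogeneous_isometries:
  fixes A :: "'a cstar_alg" and V :: "nat \<Rightarrow> 'a"
  assumes A: "unital_cstar_algebra A" and act: "one_parameter_action A \<sigma>"
    and period: "\<And>x. x \<in> carrier A \<Longrightarrow> \<sigma> 1 x = x"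
    and V: "\<And>j. V j \<in> carrier A" "\<And>j. star A (V j) \<otimes>\<^bsub>A\<^esub> V j = \<one>\<^bsub>A\<^esub>"
      "\<And>i j. i \<noteq> j \<Longrightarrow> star A (V i) \<otimes>\<^bsub>A\<^esub> V j = \<zero>\<^bsub>A\<^esub>"
    and hom: "\<And>j t. \<sigma> t (V j) = cis (2 * pi * of_int k * t) \<odot>\<^bsub>A\<^esub> V j"
  shows "\<not> kms_state A \<sigma> \<phi>"
proof
  assume "kms_state A \<sigma> \<phi>"
  then obtain b where kms: "kms_state_at A \<sigma> b \<phi>"
    by (auto simp: kms_state_def)
  hence st: "state A \<phi>"
    by (simp add: kms_state_at_def)
  interpret unital_cstar_algebra A by fact
  define q where "q = (\<lambda>j. V j \<otimes>\<^bsub>A\<^esub> star A (V j))"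
  define c where "c = complex_of_real (exp (2 * pi * of_int k * b))"
  have [simp]: "V j \<in> carrier A" "star A (V j) \<in> carrier A" "q j \<in> carrier A" for j
    using V by (auto simp: q_def star_closed)
  have q: "star A (q j) = q j" "q j \<otimes>\<^bsub>A\<^esub> q j = q j" for j
  proof -
    show "star A (q j) = q j"
      by (simp add: q_def star_mult star_star)
    have "q j \<otimes>\<^bsub>A\<^esub> q j = V j \<otimes>\<^bsub>A\<^esub> (star A (V j) \<otimes>\<^bsub>A\<^esub> V j) \<otimes>\<^bsub>A\<^esub> star A (V j)"
      unfolding q_def by (simp add: m_assoc del: V(2))
    thus "q j \<otimes>\<^bsub>A\<^esub> q j = q j"
      by (simp add: V q_def)
  qed
  have orth: "q i \<otimes>\<^bsub>A\<^esub> q j = \<zero>\<^bsub>A\<^esub>" if "i \<noteq> j" for i j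
  proof -
    have "q i \<otimes>\<^bsub>A\<^esub> q j = V i \<otimes>\<^bsub>A\<^esub> (star A (V i) \<otimes>\<^bsub>A\<^esub> V j) \<otimes>\<^bsub>A\<^esub> star A (V j)"
      unfolding q_def by (simp add: m_assoc)
    thus ?thesis
      using V(3)[OF that] by simp
  qed
  define T where "T = (\<lambda>n. \<Oplus>\<^bsub>A\<^esub>j \<in> {..<n}. q j)"
  have T_closed [simp]: "T n \<in> carrier A" for n
    by (auto simp: T_def intro!: finsum_closed)
  have T_Suc: "T (Suc n) = q n \<oplus>\<^bsub>A\<^esub> T n" for n
    by (simp add: T_def lessThan_Suc Pi_def)
  have T_orth: "T m \<otimes>\<^bsub>A\<^esub> q n = \<zero>\<^bsub>A\<^esub> \<and> q n \<otimes>\<^bsub>A\<^esub> T m = \<zero>\<^bsub>A\<^esub>" if "m \<le> n" for m n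
    using that
  proof (induction m)
    case (Suc m)
    thus ?case
      by (simp add: T_Suc l_distr r_distr orth)
  qed (simp add: T_def)
  \<comment> \<open>This is the source of the uniform bound: the value of the state at
    \<open>T n\<close> has modulus at most 1 for every n, although it is n times a fixed nonzero
    number.\<close>
  have T_projection: "projection (T n)" for n
  proof (induction n)
    case (Suc n)
    thus ?case
      using T_orth[of n n] by (simp add: projection_def T_Suc star_add l_distr r_distr q)
  qed (simp add: T_def projection_def)
  have "c * \<phi> (q j) = \<phi> \<one>\<^bsub>A\<^esub>" for j
    using kms_homogeneous[OF A act kms period V(1) hom, of j] by (simp add: V q_def c_def)
  hence \<phi>_q: "\<phi> (q j) = \<phi> \<one>\<^bsub>A\<^esub> / c" for j
    by (simp add: c_def field_simps)
  have \<phi>_T: "\<phi> (T n) = of_nat n * (\<phi> \<one>\<^bsub>A\<^esub> / c)" for n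
  proof (induction n)
    case 0
    show ?case
      by (simp add: T_def state_zero[OF A st])
  next
    case (Suc n)
    thus ?case
      by (simp add: T_Suc state_add[OF st] \<phi>_q algebra_simps add_divide_distrib)
  qed
  have "real n * cmod (\<phi> \<one>\<^bsub>A\<^esub> / c) \<le> 1" for n
  proof -
    have "real n * cmod (\<phi> \<one>\<^bsub>A\<^esub> / c) = cmod (\<phi> (T n))"
      by (simp add: \<phi>_T Real_Vector_Spaces.norm_mult norm_divide)
    thus ?thesis
      using state_norm_le[OF A st T_closed, of n] norm_projection_le[OF T_projection, of n] by linarith
  qed
  moreover have "cmod (\<phi> \<one>\<^bsub>A\<^esub> / c) > 0"
    using state_one_nonzero[OF A st] by (simp add: c_def)
  ultimately show False
    by (metis ex_less_of_nat_mult not_le)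
qed

section \<open>The algebras \<open>O\<^bsub>B\<^sup>\<infinity>\<^esub>\<close>\<close>

text \<open>Both claims grow together: once the partial sum R_n is a projection, R_n + q_n \<le> 1
  forces R_n q_n = 0, which makes R_(n+1) a projection.\<close>

lemma range_sum_orthogonal:
  assumes A: "unital_cstar_algebra A" and rel: "O_infty_relations B A S"
  defines "q \<equiv> \<lambda>j. S j \<otimes>\<^bsub>A\<^esub> star A (S j)"
  shows "unital_cstar_algebra.projection A (range_sum A S n)"
    and "m \<le> n \<Longrightarrow> range_sum A S m \<otimes>\<^bsub>A\<^esub> q n = \<zero>\<^bsub>A\<^esub>"
proof -
  interpret unital_cstar_algebra A by fact
  let ?R = "range_sum A S"
  have S [simp]: "S j \<in> carrier A" "star A (S j) \<in> carrier A" for j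
    using rel by (auto simp: O_infty_relations_def star_closed)
  have SSS: "S j \<otimes>\<^bsub>A\<^esub> star A (S j) \<otimes>\<^bsub>A\<^esub> S j = S j" for j
    using rel by (auto simp: O_infty_relations_def)
  have q [simp]: "q j \<in> carrier A" for j
    by (simp add: q_def)
  have q_projection: "projection (q j)" for j
    using SSS[of j] by (simp add: projection_def q_def star_mult star_star flip: m_assoc)
  have R_Suc: "?R (Suc n) = q n \<oplus>\<^bsub>A\<^esub> ?R n" for n
    by (simp add: range_sum_def lessThan_Suc Pi_def q_def)
  have R_closed [simp]: "?R n \<in> carrier A" for n
    by (auto simp: range_sum_def intro!: finsum_closed)
  have orth: "?R n \<otimes>\<^bsub>A\<^esub> q n = \<zero>\<^bsub>A\<^esub>" if "projection (?R n)" for n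
  proof (rule orthogonal_if_sum_le_one[OF that q_projection])
    have "cstar_le A (?R (Suc n)) \<one>\<^bsub>A\<^esub>"
      using rel unfolding O_infty_relations_def by blast
    thus "cstar_le A (?R n \<oplus>\<^bsub>A\<^esub> q n) \<one>\<^bsub>A\<^esub>"
      by (simp add: R_Suc a_comm)
  qed
  show projection: "projection (?R n)" for n
  proof (induction n)
    case (Suc n)
    have "star A (?R n \<otimes>\<^bsub>A\<^esub> q n) = q n \<otimes>\<^bsub>A\<^esub> ?R n"
      using Suc q_projection[of n] by (simp add: star_mult projection_def)
    hence "q n \<otimes>\<^bsub>A\<^esub> ?R n = \<zero>\<^bsub>A\<^esub>"
      by (simp add: orth[OF Suc])
    thus ?case
      using Suc q_projection[of n] orth[OF Suc]
      by (simp add: projection_def R_Suc star_add l_distr r_distr)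
  qed (simp add: range_sum_def projection_def)
  show "?R m \<otimes>\<^bsub>A\<^esub> q n = \<zero>\<^bsub>A\<^esub>" if "m \<le> n"
  proof -
    \<comment> \<open>Absorption of R_m by R_n passes the orthogonality to q_n from R_n down to
      R_m.\<close>
    have "?R m \<otimes>\<^bsub>A\<^esub> ?R n = ?R m"
      using that
    proof (induction n rule: dec_induct)
      case base
      show ?case using projection by (simp add: projection_def)
    next
      case (step n)
      have "?R m \<otimes>\<^bsub>A\<^esub> q n = ?R m \<otimes>\<^bsub>A\<^esub> ?R n \<otimes>\<^bsub>A\<^esub> q n"
        by (simp only: step.IH)
      also have "\<dots> = \<zero>\<^bsub>A\<^esub>"
        using orth[OF projection] by (simp add: m_assoc)
      finally show ?case
        using step by (simp add: R_Suc r_distr)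
    qed
    hence "?R m \<otimes>\<^bsub>A\<^esub> q n = ?R m \<otimes>\<^bsub>A\<^esub> ?R n \<otimes>\<^bsub>A\<^esub> q n"
      by simp
    thus ?thesis
      using orth[OF projection] by (simp add: m_assoc)
  qed
qed

lemma O_infty_orthogonal_ranges:
  assumes A: "unital_cstar_algebra A" and rel: "O_infty_relations B A S"
  shows "m \<le> n \<Longrightarrow> range_sum A S m \<otimes>\<^bsub>A\<^esub> S n = \<zero>\<^bsub>A\<^esub>"
    and "i \<noteq> j \<Longrightarrow> star A (S i) \<otimes>\<^bsub>A\<^esub> S j = \<zero>\<^bsub>A\<^esub>"
proof -
  interpret unital_cstar_algebra A by fact
  let ?R = "range_sum A S" and ?q = "\<lambda>j. S j \<otimes>\<^bsub>A\<^esub> star A (S j)"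
  have S [simp]: "S j \<in> carrier A" "star A (S j) \<in> carrier A" for j
    using rel by (auto simp: O_infty_relations_def star_closed)
  have SSS: "?q j \<otimes>\<^bsub>A\<^esub> S j = S j" for j
    using rel by (auto simp: O_infty_relations_def)
  have R_closed [simp]: "?R n \<in> carrier A" for n
    by (auto simp: range_sum_def intro!: finsum_closed)
  have RS: "?R m \<otimes>\<^bsub>A\<^esub> S n = \<zero>\<^bsub>A\<^esub>" if "m \<le> n" for m n
  proof -
    have "?R m \<otimes>\<^bsub>A\<^esub> S n = ?R m \<otimes>\<^bsub>A\<^esub> ?q n \<otimes>\<^bsub>A\<^esub> S n"
      using SSS[of n] by (simp add: m_assoc)
    thus ?thesis
      using range_sum_orthogonal(2)[OF A rel that] by simp
  qed
  thus "m \<le> n \<Longrightarrow> ?R m \<otimes>\<^bsub>A\<^esub> S n = \<zero>\<^bsub>A\<^esub>" by simp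
  have less: "star A (S i) \<otimes>\<^bsub>A\<^esub> S j = \<zero>\<^bsub>A\<^esub>" if "i < j" for i j
  proof -
    \<comment> \<open>The range projection of S_i is the difference of two consecutive partial sums,
      and both annihilate S_j because i + 1 \<le> j.\<close>
    have "?R (Suc i) = ?q i \<oplus>\<^bsub>A\<^esub> ?R i"
      by (simp add: range_sum_def lessThan_Suc Pi_def)
    hence "?q i \<otimes>\<^bsub>A\<^esub> S j = \<zero>\<^bsub>A\<^esub>"
      using RS[of i j] RS[of "Suc i" j] that by (simp add: l_distr)
    moreover have "star A (S i) = star A (S i) \<otimes>\<^bsub>A\<^esub> ?q i"
      using arg_cong[OF SSS[of i], of "star A"] by (simp add: star_mult star_star m_assoc)
    ultimately show ?thesis
      by (metis S m_assoc m_closed r_null)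
  qed
  have "star A (S i) \<otimes>\<^bsub>A\<^esub> S j = \<zero>\<^bsub>A\<^esub>" if "j < i" for i j
    using arg_cong[OF less[OF that], of "star A"] by (simp add: star_mult star_star)
  with less show "i \<noteq> j \<Longrightarrow> star A (S i) \<otimes>\<^bsub>A\<^esub> S j = \<zero>\<^bsub>A\<^esub>"
    by (metis linorder_neqE_nat)
qed

text \<open>
  The compressions \<open>S\<^sub>j P\<^sub>N\<close> lie in the corner and are isometries there, since
  \<open>P\<^sub>N S\<^sub>j = S\<^sub>j\<close> for \<open>j \<ge> N\<close>.
\<close>

lemma no_kms_state_O_infty:
  fixes U :: "'a cstar_alg" and k :: "nat \<Rightarrow> int"
  assumes O: "is_O_infty B U S" and act: "one_parameter_action U \<sigma>"
    and \<sigma>_S: "\<And>t j. \<sigma> t (S j) = cis (2 * pi * of_int (k j) * t) \<odot>\<^bsub>U\<^esub> S j"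
    and k: "\<And>j. j \<ge> dim_row B \<Longrightarrow> k j = l"
  shows "\<not> kms_state U \<sigma> \<phi>"
    and "\<not> kms_state (reciprocal_dual (dim_row B) U S) \<sigma> \<phi>"
proof -
  have A: "unital_cstar_algebra U" and rel: "O_infty_relations B U S" and gen: "generates U S"
    using O by (auto simp: is_O_infty_def)
  interpret unital_cstar_algebra U by fact
  define N where "N = dim_row B"
  have S [simp]: "S j \<in> carrier U" "star U (S j) \<in> carrier U" for j
    using rel by (auto simp: O_infty_relations_def star_closed)
  have isometry: "star U (S j) \<otimes>\<^bsub>U\<^esub> S j = \<one>\<^bsub>U\<^esub>" if "j \<ge> N" for j
    using rel that by (auto simp: O_infty_relations_def N_def)
  note orth = O_infty_orthogonal_ranges[OF A rel]
  have hom: "star_hom U U (\<sigma> t)" for t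
    using act by (simp add: one_parameter_action_def star_automorphism_def)
  hence ring: "\<sigma> t \<in> ring_hom U U" for t
    by (simp add: star_hom_def)
  have cis_1: "cis (2 * pi * of_int n) = 1" for n
    using cis_multiple_2pi[of "of_int n"] by simp
  \<comment> \<open>At time 1 the phases of all generators are 1, since the degrees are
    integers.\<close>
  have period: "\<sigma> 1 x = x" if "x \<in> carrier U" for x
    by (rule star_hom_fixes_if_generates[OF A hom gen]) (use that in \<open>auto simp: \<sigma>_S cis_1 scale_one\<close>)
  show "\<not> kms_state U \<sigma> \<phi>"
    by (rule no_kms_state_if_homogeneous_isometries[OF A act period, of "\<lambda>j. S (N + j)" l])
      (auto simp: isometry orth \<sigma>_S k N_def)

  define P where "P = defect_projection U S N"
  have P_def': "P = \<one>\<^bsub>U\<^esub> \<ominus>\<^bsub>U\<^esub> range_sum U S N"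
    by (simp add: P_def defect_projection_def)
  have P: "projection P"
    unfolding P_def' by (intro projection_complement range_sum_orthogonal[OF A rel])
  hence P' [simp]: "P \<in> carrier U" "star U P = P" "P \<otimes>\<^bsub>U\<^esub> P = P"
    by (auto simp: projection_def)
  have R_closed [simp]: "range_sum U S n \<in> carrier U" for n
    by (auto simp: range_sum_def intro!: finsum_closed)
  \<comment> \<open>The phases of S_n and its adjoint are conjugate and cancel in the range
    projection.\<close>
  have \<sigma>_R: "\<sigma> t (range_sum U S n) = range_sum U S n" for t n
  proof (induction n)
    case 0
    show ?case
      using ring_hom_zero[OF ring ring_axioms ring_axioms] by (simp add: range_sum_def)
  next
    case (Suc n)
    have "\<sigma> t (star U (S n)) = cnj (cis (2 * pi * of_int (k n) * t)) \<odot>\<^bsub>U\<^esub> star U (S n)"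
      using hom by (simp add: star_hom_def \<sigma>_S star_scale)
    hence "\<sigma> t (S n \<otimes>\<^bsub>U\<^esub> star U (S n)) = S n \<otimes>\<^bsub>U\<^esub> star U (S n)"
      by (simp add: ring_hom_mult[OF ring] \<sigma>_S scale_mult_left scale_mult_right scale_closed
          cis_cnj cis_mult scale_one flip: scale_scale)
    moreover have "range_sum U S (Suc n) = S n \<otimes>\<^bsub>U\<^esub> star U (S n) \<oplus>\<^bsub>U\<^esub> range_sum U S n"
      by (simp add: range_sum_def lessThan_Suc Pi_def)
    ultimately show ?case
      using Suc by (simp add: ring_hom_add[OF ring])
  qed
  have \<sigma>_P: "\<sigma> t P = P" for t
    by (simp add: P_def' star_hom_diff[OF A A hom] ring_hom_one[OF ring] \<sigma>_R)
  let ?C = "corner U P"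
  have C: "unital_cstar_algebra ?C"
    by (rule unital_cstar_algebra_corner[OF P])
  have act_C: "one_parameter_action ?C \<sigma>"
    by (rule one_parameter_action_corner[OF A act P \<sigma>_P])
  define V where "V = (\<lambda>j. S (N + j) \<otimes>\<^bsub>U\<^esub> P)"
  have PS: "P \<otimes>\<^bsub>U\<^esub> S j = S j" if "j \<ge> N" for j
    using orth(1)[OF that] by (simp add: P_def' minus_eq l_distr l_minus)
  have V_A: "V j \<in> carrier U" for j
    by (simp add: V_def)
  have V_star: "star ?C (V i) \<otimes>\<^bsub>?C\<^esub> V j = P \<otimes>\<^bsub>U\<^esub> (star U (S (N + i)) \<otimes>\<^bsub>U\<^esub> S (N + j)) \<otimes>\<^bsub>U\<^esub> P"
    for i j
    by (simp add: V_def star_mult m_assoc)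
  have "\<not> kms_state ?C \<sigma> \<phi>"
  proof (rule no_kms_state_if_homogeneous_isometries[OF C act_C, of V l])
    show "\<sigma> 1 x = x" if "x \<in> carrier ?C" for x
      using that P by (simp add: mem_corner_iff period)
    show "V j \<in> carrier ?C" for j
      using P PS[of "N + j"] by (simp add: mem_corner_iff V_def m_assoc flip: m_assoc[of P])
    show "star ?C (V j) \<otimes>\<^bsub>?C\<^esub> V j = \<one>\<^bsub>?C\<^esub>" for j
      unfolding V_star by (simp add: isometry)
    show "star ?C (V i) \<otimes>\<^bsub>?C\<^esub> V j = \<zero>\<^bsub>?C\<^esub>" if "i \<noteq> j" for i j
      unfolding V_star using that by (simp add: orth)
    show "\<sigma> t (V j) = cis (2 * pi * of_int l * t) \<odot>\<^bsub>?C\<^esub> V j" for j t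
      by (simp add: V_def ring_hom_mult[OF ring] \<sigma>_S \<sigma>_P k N_def scale_mult_left)
  qed
  thus "\<not> kms_state (reciprocal_dual (dim_row B) U S) \<sigma> \<phi>"
    by (simp add: reciprocal_dual_def P_def N_def)
qed

section \<open>Application to the three actions\<close>

text \<open>The degrees below N and from N on are 1 and 0 for \<alpha>, 0 and 1 for \<beta>, 1 and 1
  for \<gamma>. The common degree l = 0 of \<alpha> is as good as any other: the range projections
  then have the value \<phi>(1) whatever b is.\<close>

lemma action_degrees:
  assumes A: "unital_cstar_algebra U" and S: "\<And>j. S j \<in> carrier U"
    and act: "is_alpha_action N U S \<sigma> \<or> is_beta_action N U S \<sigma> \<or> is_gamma_action U S \<sigma>"
  obtains k :: "nat \<Rightarrow> int" and l where "one_parameter_action U \<sigma>"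
    "\<And>t j. \<sigma> t (S j) = cis (2 * pi * of_int (k j) * t) \<odot>\<^bsub>U\<^esub> S j" "\<And>j. j \<ge> N \<Longrightarrow> k j = l"
proof -
  interpret unital_cstar_algebra U by fact
  note [simp] = scale_one[OF S]
  from act show thesis
  proof (elim disjE)
    assume "is_alpha_action N U S \<sigma>"
    thus thesis
      by (intro that[of "\<lambda>j. if j < N then 1 else 0" 0]) (auto simp: is_alpha_action_def)
  next
    assume "is_beta_action N U S \<sigma>"
    thus thesis
      by (intro that[of "\<lambda>j. if j < N then 0 else 1" 1]) (auto simp: is_beta_action_def)
  next
    assume "is_gamma_action U S \<sigma>"
    thus thesis
      by (intro that[of "\<lambda>_. 1" 1]) (auto simp: is_gamma_action_def)
  qed
qed

lemma no_kms_state_alpha_beta_gamma: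
  fixes U :: "'a cstar_alg"
  assumes O: "is_O_infty B U S" and N: "dim_row B = N"
    and act: "is_alpha_action N U S \<sigma> \<or> is_beta_action N U S \<sigma> \<or> is_gamma_action U S \<sigma>"
  shows "\<not> kms_state U \<sigma> \<phi>" and "\<not> kms_state (reciprocal_dual N U S) \<sigma> \<phi>"
proof -
  have "unital_cstar_algebra U" "\<And>j. S j \<in> carrier U"
    using O by (auto simp: is_O_infty_def O_infty_relations_def)
  from action_degrees[OF this act] obtain k :: "nat \<Rightarrow> int" and l where k:
    "one_parameter_action U \<sigma>" "\<And>t j. \<sigma> t (S j) = cis (2 * pi * of_int (k j) * t) \<odot>\<^bsub>U\<^esub> S j"
    "\<And>j. j \<ge> dim_row B \<Longrightarrow> k j = l"
    unfolding N by blast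
  show "\<not> kms_state U \<sigma> \<phi>" "\<not> kms_state (reciprocal_dual N U S) \<sigma> \<phi>"
    using no_kms_state_O_infty[OF O k] by (simp_all add: N)
qed

theorem mainTheorem17:
  fixes A :: "nat mat" and N :: nat
  assumes "A \<in> carrier_mat N N"
    and "elements_mat A \<subseteq> {0, 1}"
    and "irreducible_matrix A"
    and "\<not> permutation_matrix A"
  shows "(\<forall>(U :: 'a cstar_alg) S \<sigma>.
            is_O_infty A U S \<and>
            (is_alpha_action N U S \<sigma> \<or> is_beta_action N U S \<sigma> \<or> is_gamma_action U S \<sigma>) \<longrightarrow>
            \<not> (\<exists>\<phi>. kms_state U \<sigma> \<phi>)) \<and>
         (\<forall>(U :: 'a cstar_alg) S \<sigma>.
            is_O_infty (transpose_mat A) U S \<and>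
            (is_alpha_action N U S \<sigma> \<or> is_beta_action N U S \<sigma> \<or> is_gamma_action U S \<sigma>) \<longrightarrow>
            \<not> (\<exists>\<phi>. kms_state (reciprocal_dual N U S) \<sigma> \<phi>))"
proof -
  have dims: "dim_row A = N" "dim_row (transpose_mat A) = N"
    using assms(1) by auto
  show ?thesis
    using no_kms_state_alpha_beta_gamma(1)[OF _ dims(1)] no_kms_state_alpha_beta_gamma(2)[OF _ dims(2)]
    by blast
qed

end
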